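(* Let $n\in\mathbb{N}$, let $\Omega\subseteq\mathbb{R}^n$ be an unbounded domain, and let $T\in(0,\infty)$. Let $a_{ij},b_i:\Omega_T\to\mathbb{R}$ ($i,j=1,\dots,n$), and suppose there is a constant $A_{\min}>0$ such that $$A_{\min}|\eta|^2\le \sum_{i,j=1}^n a_{ij}(x,t)\eta_i\eta_j\qquad\forall (x,t)\in\Omega_T,\ \eta\in\mathbb{R}^n .$$ Let $f:\Omega_T\times\mathbb{R}^2\to\mathbb{R}$, let $\phi\in L^1(\mathbb{R}^n)$ with $\phi\ge 0$ on $\mathbb{R}^n$, let $Ju(x,t)=\int_\Omega \phi(x-y)u(y,t)\,dy$, and let $P$ be the operator $$P[u]=\sum_{i,j=1}^n a_{ij}\,\partial_{x_ix_j}u+\sum_{i=1}^n b_i\,\partial_{x_i}u+f(\cdot,u,Ju)-\partial_t u\qquad\text{on }\Omega_T .$$ Let $\psi(x)=\phi(x)|x|^2$ for $x\in\mathbb{R}^n$. Let $\underline u,\overline u\in \mathcal{C}(\overline{\Omega}_T)\cap \mathcal{C}^{2,1}(\Omega_T)\cap L^\infty(\overline{\Omega}_T)$ and let $$\mathcal{K}=\Big[\inf_{\overline\Omega_T}\min\{\overline u,\underline u\},\ \sup_{\overline\Omega_T}\max\{\overline u,\underline u\}\Big]\times\Big[\inf_{\overline\Omega_T}\min\{J\overline u,J\underline u\},\ \sup_{\overline\Omega_T}\max\{J\overline u,J\underline u\}\Big].$$ Suppose that, for some non-negative constants $A,B$: (i) $P[\underline u]\ge P[\overline u]$ on $\Omega_T$;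 (ii) $\underline u\le\overline u$ on $\partial\Omega_T$; (iii) $\sum_{i,j=1}^n a_{ij}(x,t)\eta_i\eta_j\le A(1+|x|^2)|\eta|^2$ for all $(x,t)\in\Omega_T$, $\eta\in\mathbb{R}^n$; (iv) $\sum_{i=1}^n b_i(x,t)x_i\le B(1+|x|^2)$ for all $(x,t)\in\Omega_T$; (v) $\psi\in L^1(\mathbb{R}^n)$; (vi) $f=f(x,t,u,v)$ satisfies an upper Lipschitz condition in $u$ on $\Omega_T\times\mathcal{K}$; (vii) $f=f(x,t,u,v)$ satisfies a Lipschitz condition in $v$ (the argument in which $Ju$ is inserted) on $\Omega_T\times\mathcal{K}$; (viii) $f=f(x,t,u,v)$ is non-decreasing with respect to $v$ on $\Omega_T\times\mathcal{K}$. Then $\underline u\le\overline u$ on $\overline{\Omega}_T$.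
   Context: Notation: $\Omega_T=\Omega\times(0,T]$; $\partial\Omega_T=(\Omega\times\{0\})\cup(\partial\Omega\times(0,T))$ (the parabolic boundary, where $\partial\Omega$ is the topological boundary of $\Omega$ in $\mathbb{R}^n$); $\overline{\Omega}_T$ is the closure of $\Omega_T$, i.e. $\overline{\Omega}\times[0,T]$. $|\cdot|$ is the Euclidean norm on $\mathbb{R}^n$. $\mathcal{C}(X)$ is the set of continuous real-valued functions on $X$. $\mathcal{C}^{2,1}(\Omega_T)$ is the set of continuous $u:\Omega_T\to\mathbb{R}$ whose spatial partial derivatives up to order $2$ (including mixed ones) and first time derivative $\partial_t u$ exist and are continuous on $\Omega_T$ (at $t=T$ the time derivative is one-sided). $L^\infty(X)$ denotes the (essentially) bounded real-valued functions on $X$. In $P[u]$, $f(\cdot,u,Ju)$ denotes $(x,t)\mapsto f(x,t,u(x,t),Ju(x,t))$. The formula for $Ju$ is used at all points of $\overline{\Omega}_T$. For $\mathcal{K}\subseteq\mathbb{R}^2$: - $f$ satisfies an upper Lipschitz condition in $u$ on $\Omega_T\times\mathcal{K}$ if there is a constant $k\ge0$ with $f(x,t,u_1,v)-f(x,t,u_2,v)\le k(u_1-u_2)$ for all $(x,t)\in\Omega_T$ and $(u_1,v),(u_2,v)\in\mathcal{K}$ such that $u_1\ge u_2$. - $f$ satisfies a Lipschitz condition in $v$ on $\Omega_T\times\mathcal{K}$ if there is a constant $k\ge0$ with $|f(x,t,u,v_1)-f(x,t,u,v_2)|\le k|v_1-v_2|$ for all $(x,t)\in\Omega_T$ and $(u,v_1),(u,v_2)\in\mathcal{K}$.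 - $f$ is non-decreasing with respect to $v$ on $\Omega_T\times\mathcal{K}$ if $f(x,t,u,v_1)\le f(x,t,u,v_2)$ for all $(x,t)\in\Omega_T$ and $(u,v_1),(u,v_2)\in\mathcal{K}$ with $v_1\le v_2$. *)

theory Defs
  imports "HOL-Analysis.Analysis"
begin

text \<open>Space-time points are pairs of type \<open>(real ^ 'n) \<times> real\<close>. Functions on subsets of space-time
  are total HOL functions; all notions below only look at their values on the relevant subset.\<close>

definition cyl :: "(real ^ 'n) set \<Rightarrow> real \<Rightarrow> ((real ^ 'n) \<times> real) set" where
  "cyl \<Omega> T = \<Omega> \<times> {0<..T}"

definition parabolic_boundary :: "(real ^ 'n) set \<Rightarrow> real \<Rightarrow> ((real ^ 'n) \<times> real) set" where
  "parabolic_boundary \<Omega> T = (\<Omega> \<times> {0}) \<union> (frontier \<Omega> \<times> {0<..<T})"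

lemma closure_cyl: "T > 0 \<Longrightarrow> closure (cyl \<Omega> T) = closure \<Omega> \<times> {0..T}"
  by (simp add: cyl_def closure_Times)

definition partial_x :: "'n \<Rightarrow> ((real ^ 'n) \<times> real \<Rightarrow> real) \<Rightarrow> (real ^ 'n) \<times> real \<Rightarrow> real" where
  "partial_x i u = (\<lambda>(x, t). deriv (\<lambda>h. u (x + h *\<^sub>R axis i 1, t)) 0)"

definition has_partial_x_on ::
    "'n \<Rightarrow> ((real ^ 'n) \<times> real \<Rightarrow> real) \<Rightarrow> ((real ^ 'n) \<times> real) set \<Rightarrow> bool" where
  "has_partial_x_on i u D \<longleftrightarrow>
     (\<forall>(x, t)\<in>D. (\<lambda>h. u (x + h *\<^sub>R axis i 1, t)) field_differentiable at 0)"

text \<open>The derivative is taken within \<open>{0<..T}\<close>, so it is one-sided exactly at \<open>t = T\<close>.\<close>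

definition partial_t :: "real \<Rightarrow> ((real ^ 'n) \<times> real \<Rightarrow> real) \<Rightarrow> (real ^ 'n) \<times> real \<Rightarrow> real" where
  "partial_t T u = (\<lambda>(x, t). vector_derivative (\<lambda>s. u (x, s)) (at t within {0<..T}))"

definition has_partial_t_on ::
    "real \<Rightarrow> ((real ^ 'n) \<times> real \<Rightarrow> real) \<Rightarrow> ((real ^ 'n) \<times> real) set \<Rightarrow> bool" where
  "has_partial_t_on T u D \<longleftrightarrow>
     (\<forall>(x, t)\<in>D. (\<lambda>s. u (x, s)) differentiable (at t within {0<..T}))"

definition C21 :: "(real ^ 'n) set \<Rightarrow> real \<Rightarrow> ((real ^ 'n) \<times> real \<Rightarrow> real) set" where
  "C21 \<Omega> T = {u.
     continuous_on (cyl \<Omega> T) u \<and>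
     (\<forall>i. has_partial_x_on i u (cyl \<Omega> T) \<and> continuous_on (cyl \<Omega> T) (partial_x i u)) \<and>
     (\<forall>i j. has_partial_x_on i (partial_x j u) (cyl \<Omega> T) \<and>
            continuous_on (cyl \<Omega> T) (partial_x i (partial_x j u))) \<and>
     has_partial_t_on T u (cyl \<Omega> T) \<and> continuous_on (cyl \<Omega> T) (partial_t T u)}"

definition Linfty :: "'a::euclidean_space set \<Rightarrow> ('a \<Rightarrow> real) set" where
  "Linfty X = {u. u \<in> borel_measurable (lebesgue_on X) \<and>
                  (\<exists>M. AE z in lebesgue_on X. \<bar>u z\<bar> \<le> M)}"

definition nonlocal ::
    "(real ^ 'n) set \<Rightarrow> (real ^ 'n \<Rightarrow> real) \<Rightarrow> ((real ^ 'n) \<times> real \<Rightarrow> real) \<Rightarrow> (real ^ 'n) \<times> real \<Rightarrow> real" where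
  "nonlocal \<Omega> \<phi> u = (\<lambda>(x, t). LINT y:\<Omega>|lebesgue. \<phi> (x - y) * u (y, t))"

definition P_op ::
    "('n::finite \<Rightarrow> 'n \<Rightarrow> (real ^ 'n) \<times> real \<Rightarrow> real) \<Rightarrow> ('n \<Rightarrow> (real ^ 'n) \<times> real \<Rightarrow> real) \<Rightarrow>
     ((real ^ 'n) \<times> real \<Rightarrow> real \<Rightarrow> real \<Rightarrow> real) \<Rightarrow> (real ^ 'n \<Rightarrow> real) \<Rightarrow> (real ^ 'n) set \<Rightarrow> real \<Rightarrow>
     ((real ^ 'n) \<times> real \<Rightarrow> real) \<Rightarrow> (real ^ 'n) \<times> real \<Rightarrow> real" where
  "P_op a b f \<phi> \<Omega> T u z =
     (\<Sum>i\<in>UNIV. \<Sum>j\<in>UNIV. a i j z * partial_x i (partial_x j u) z)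
     + (\<Sum>i\<in>UNIV. b i z * partial_x i u z)
     + f z (u z) (nonlocal \<Omega> \<phi> u z)
     - partial_t T u z"

definition K_set ::
    "(real ^ 'n) set \<Rightarrow> real \<Rightarrow> (real ^ 'n \<Rightarrow> real) \<Rightarrow>
     ((real ^ 'n) \<times> real \<Rightarrow> real) \<Rightarrow> ((real ^ 'n) \<times> real \<Rightarrow> real) \<Rightarrow> (real \<times> real) set" where
  "K_set \<Omega> T \<phi> ul uu =
     {(INF z\<in>closure (cyl \<Omega> T). min (uu z) (ul z)) ..
      (SUP z\<in>closure (cyl \<Omega> T). max (uu z) (ul z))} \<times>
     {(INF z\<in>closure (cyl \<Omega> T). min (nonlocal \<Omega> \<phi> uu z) (nonlocal \<Omega> \<phi> ul z)) ..
      (SUP z\<in>closure (cyl \<Omega> T). max (nonlocal \<Omega> \<phi> uu z) (nonlocal \<Omega> \<phi> ul z))}"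

definition upper_lipschitz_u ::
    "('a \<Rightarrow> real \<Rightarrow> real \<Rightarrow> real) \<Rightarrow> 'a set \<Rightarrow> (real \<times> real) set \<Rightarrow> bool" where
  "upper_lipschitz_u f D K \<longleftrightarrow>
     (\<exists>k\<ge>0. \<forall>z\<in>D. \<forall>u1 u2 v. (u1, v) \<in> K \<and> (u2, v) \<in> K \<and> u1 \<ge> u2 \<longrightarrow>
        f z u1 v - f z u2 v \<le> k * (u1 - u2))"

definition lipschitz_v ::
    "('a \<Rightarrow> real \<Rightarrow> real \<Rightarrow> real) \<Rightarrow> 'a set \<Rightarrow> (real \<times> real) set \<Rightarrow> bool" where
  "lipschitz_v f D K \<longleftrightarrow>
     (\<exists>k\<ge>0. \<forall>z\<in>D. \<forall>u v1 v2. (u, v1) \<in> K \<and> (u, v2) \<in> K \<longrightarrow>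
        \<bar>f z u v1 - f z u v2\<bar> \<le> k * \<bar>v1 - v2\<bar>)"

definition nondecreasing_v ::
    "('a \<Rightarrow> real \<Rightarrow> real \<Rightarrow> real) \<Rightarrow> 'a set \<Rightarrow> (real \<times> real) set \<Rightarrow> bool" where
  "nondecreasing_v f D K \<longleftrightarrow>
     (\<forall>z\<in>D. \<forall>u v1 v2. (u, v1) \<in> K \<and> (u, v2) \<in> K \<and> v1 \<le> v2 \<longrightarrow> f z u v1 \<le> f z u v2)"

end

theory Submission
  imports Defs
begin

text \<open>
  The difference \<open>w = ul - uu\<close> is compared with multiples of the barrier
  \<open>e\<^bsup>\<mu>t\<^esup> (1 + \<bar>x\<bar>\<^sup>2)\<close>. Suppose \<open>w\<close> is positive somewhere. Since \<open>w\<close> is bounded and the barrier grows at infinity,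
  their quotient attains a positive maximum \<open>m\<close> on the closed cylinder, even though the domain is unbounded
  (\<open>touching_barrier\<close>). So \<open>w\<close> stays below \<open>m\<close> times the barrier and touches it at one point, and this point
  belongs to \<open>\<Omega> \<times> (0, T]\<close> because \<open>w \<le> 0\<close> on the rest of the closure (\<open>nonpos_off_cyl\<close>).

  At the touching point the gradients agree, the second-order part of the operator applied to \<open>w\<close> is at most that
  of \<open>m\<close> times the barrier, and the time derivative of \<open>w\<close> is at least that of \<open>m\<close> times the barrier
  (\<open>derivatives_at_touching_point\<close>). The second-order comparison is the inequality between a positive semidefinite
  coefficient matrix and a negative semidefinite symmetric Hessian (\<open>frobenius_product_nonneg\<close>); symmetry of the
  Hessian and its sign come from \<open>mixed_partials_commute\<close> and \<open>local_max_gradient_hessian\<close>.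

  The reaction terms differ by at most \<open>k\<^sub>1 w\<close> plus \<open>k\<^sub>2\<close> times the positive part of \<open>Jw\<close>, where \<open>J\<close> is the
  nonlocal operator. As \<open>w\<close> is below \<open>m\<close> times the barrier everywhere and the kernel is nonnegative with finite
  second moment, \<open>Jw\<close> is at most a constant times \<open>m\<close> times the barrier (\<open>kernel_integral_le_quadratic\<close>). Thus the
  differential inequality at the touching point bounds \<open>\<mu>\<close> times the value of \<open>w\<close> by a constant multiple of that
  value, the constant depending only on the data. It fails when \<open>\<mu>\<close> is larger than this constant.
\<close>

section \<open>Partial derivatives and second-order conditions at a maximum\<close>

text \<open>A partial derivative of a function of the space variable alone, given as a relation: unlike \<^term>\<open>deriv\<close> it
  contains existence, so that sums and multiples need no side conditions.\<close>

definition has_partial :: "'n \<Rightarrow> (real ^ 'n \<Rightarrow> real) \<Rightarrow> real \<Rightarrow> real ^ 'n \<Rightarrow> bool" where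
  "has_partial i u d x \<longleftrightarrow> ((\<lambda>h. u (x + h *\<^sub>R axis i 1)) has_real_derivative d) (at 0)"

lemma has_partial_shift:
  assumes "has_partial i u d (x + s *\<^sub>R axis i 1)"
  shows "((\<lambda>r. u (x + r *\<^sub>R axis i 1)) has_real_derivative d) (at s)"
proof -
  have "((\<lambda>r. u (x + (r + s) *\<^sub>R axis i 1)) has_real_derivative d) (at 0)"
    using assms by (simp add: has_partial_def algebra_simps)
  then show ?thesis
    using DERIV_shift[of "\<lambda>r. u (x + r *\<^sub>R axis i 1)" d 0 s] by simp
qed

lemma partial_mvt:
  assumes "\<And>r. r \<in> {0..1} \<Longrightarrow> has_partial i u (D (x + (r * s) *\<^sub>R axis i 1)) (x + (r * s) *\<^sub>R axis i 1)"
  obtains \<theta> where "\<theta> \<in> {0..1}" "u (x + s *\<^sub>R axis i 1) - u x = s * D (x + (\<theta> * s) *\<^sub>R axis i 1)"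
proof -
  have d: "((\<lambda>r. u (x + (r * s) *\<^sub>R axis i 1)) has_real_derivative D (x + (r * s) *\<^sub>R axis i 1) * s) (at r)"
    if "0 \<le> r" "r \<le> 1" for r
    by (rule DERIV_chain'[where g = "\<lambda>r. u (x + r *\<^sub>R axis i 1)" and f = "\<lambda>r. r * s"])
      (use assms[of r] that in \<open>auto intro!: has_partial_shift derivative_eq_intros\<close>)
  obtain z where "0 < z" "z < 1"
    "u (x + (1 * s) *\<^sub>R axis i 1) - u (x + (0 * s) *\<^sub>R axis i 1) = (1 - 0) * (D (x + (z * s) *\<^sub>R axis i 1) * s)"
    using MVT2[of 0 1 "\<lambda>r. u (x + (r * s) *\<^sub>R axis i 1)" "\<lambda>r. D (x + (r * s) *\<^sub>R axis i 1) * s"] d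
    by auto
  then show thesis by (intro that[of z]) (auto simp: mult.commute)
qed

text \<open>The increment is split into steps parallel to the coordinate axes. On the step in direction \<open>k\<close> the mean
  value theorem produces a value of the \<open>k\<close>-th partial derivative at a point that is no further from \<open>x\<close> than
  the end point, so continuity makes it close to the value at \<open>x\<close>.\<close>

lemma continuous_partials_imp_has_derivative:
  fixes u :: "real ^ 'n \<Rightarrow> real"
  assumes S: "open S" "x \<in> S"
    and part: "\<And>i y. y \<in> S \<Longrightarrow> has_partial i u (D i y) y"
    and cont: "\<And>i. continuous_on S (D i)"
  shows "(u has_derivative (\<lambda>h. \<Sum>i\<in>UNIV. D i x * h $ i)) (at x)"
  unfolding has_derivative_at_alt
proof (intro conjI allI impI)
  show "bounded_linear (\<lambda>h. \<Sum>i\<in>UNIV. D i x * h $ i)"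
    by (intro bounded_linear_sum bounded_linear_const_mult bounded_linear_vec_nth)
next
  fix e :: real assume e: "e > 0"
  define e' where "e' = e / real CARD('n)"
  have e': "e' > 0" using e by (simp add: e'_def)
  have "\<forall>\<^sub>F y in at x. \<forall>i. \<bar>D i y - D i x\<bar> < e'"
  proof -
    have "isCont (D i) x" for i
      using cont[of i] S by (simp add: continuous_on_eq_continuous_at)
    then have "\<forall>\<^sub>F y in at x. \<bar>D i y - D i x\<bar> < e'" for i
      using tendstoD[of "D i" "D i x" "at x" e'] e' by (simp add: isCont_def dist_real_def)
    then show ?thesis by (simp add: eventually_all_finite)
  qed
  moreover have "\<forall>\<^sub>F y in at x. y \<in> S"
    using S by (rule eventually_at_in_open')
  ultimately have "\<forall>\<^sub>F y in at x. y \<in> S \<and> (\<forall>i. \<bar>D i y - D i x\<bar> < e')"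
    by eventually_elim auto
  then obtain r where r: "r > 0"
    and near': "\<And>y. y \<noteq> x \<Longrightarrow> dist y x < r \<Longrightarrow> y \<in> S \<and> (\<forall>i. \<bar>D i y - D i x\<bar> < e')"
    unfolding eventually_at by auto
  have near: "y \<in> S \<and> (\<forall>i. \<bar>D i y - D i x\<bar> \<le> e')" if "norm (y - x) < r" for y
    using near'[of y] that S e' by (cases "y = x") (auto simp: dist_norm less_imp_le)
  show "\<exists>d>0. \<forall>y. norm (y - x) < d \<longrightarrow>
      norm (u y - u x - (\<Sum>i\<in>UNIV. D i x * (y - x) $ i)) \<le> e * norm (y - x)"
  proof (intro exI[of _ r] conjI allI impI r)
    fix y assume y: "norm (y - x) < r"
    define h where "h = y - x"
    define p where "p F = (\<Sum>i\<in>F. h $ i *\<^sub>R axis i (1::real))" for F :: "'n set"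
    have p_nth: "p F $ j = (if j \<in> F then h $ j else 0)" if "finite F" for F j
      using that by (simp add: p_def axis_def if_distrib sum.delta cong: if_cong)
    \<comment> \<open>\<open>p F\<close> is the increment with only the coordinates in \<open>F\<close> switched on.\<close>
    have "\<bar>u (x + p F) - u x - (\<Sum>i\<in>F. D i x * h $ i)\<bar> \<le> e' * (\<Sum>i\<in>F. \<bar>h $ i\<bar>)"
      if "finite F" for F
      using that
    proof (induction F rule: finite_induct)
      case empty then show ?case by (simp add: p_def)
    next
      case (insert k F)
      have small: "norm (p F + (\<theta> * h $ k) *\<^sub>R axis k 1) < r" if "\<theta> \<in> {0..1}" for \<theta>
      proof -
        have "norm (p F + (\<theta> * h $ k) *\<^sub>R axis k 1) \<le> norm h"
        proof (rule norm_le_componentwise_cart)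
          fix j
          have "\<bar>\<theta> * h $ k\<bar> \<le> \<bar>h $ k\<bar>" using that
            by (simp add: abs_mult mult_left_le_one_le)
          then show "norm ((p F + (\<theta> * h $ k) *\<^sub>R axis k 1) $ j) \<le> norm (h $ j)"
            using insert.hyps by (auto simp: p_nth axis_def)
        qed
        then show ?thesis using y by (simp add: h_def)
      qed
      have nearF: "x + p F + (\<theta> * h $ k) *\<^sub>R axis k 1 \<in> S \<and>
          \<bar>D k (x + p F + (\<theta> * h $ k) *\<^sub>R axis k 1) - D k x\<bar> \<le> e'" if "\<theta> \<in> {0..1}" for \<theta>
        using near[of "x + p F + (\<theta> * h $ k) *\<^sub>R axis k 1"] small[OF that] by (simp add: algebra_simps)
      obtain \<theta> where \<theta>: "\<theta> \<in> {0..1}"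
        and eq: "u (x + p F + h $ k *\<^sub>R axis k 1) - u (x + p F)
          = h $ k * D k (x + p F + (\<theta> * h $ k) *\<^sub>R axis k 1)"
        by (rule partial_mvt[of k u "D k" "x + p F" "h $ k"]) (use part nearF in auto)
      have ins: "x + p (insert k F) = x + p F + h $ k *\<^sub>R axis k 1"
        using insert.hyps by (simp add: p_def algebra_simps)
      let ?q = "D k (x + p F + (\<theta> * h $ k) *\<^sub>R axis k 1)"
      have "u (x + p (insert k F)) - u x - (\<Sum>i\<in>insert k F. D i x * h $ i)
        = (u (x + p F) - u x - (\<Sum>i\<in>F. D i x * h $ i)) + (?q - D k x) * h $ k"
        using eq insert.hyps unfolding ins by (simp add: algebra_simps)
      moreover have "\<bar>(?q - D k x) * h $ k\<bar> \<le> e' * \<bar>h $ k\<bar>"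
        using nearF[OF \<theta>] by (simp add: abs_mult mult_right_mono)
      ultimately show ?case
        using insert.IH insert.hyps by (simp add: algebra_simps)
    qed
    from this[of UNIV] have "\<bar>u (x + p UNIV) - u x - (\<Sum>i\<in>UNIV. D i x * h $ i)\<bar> \<le> e' * (\<Sum>i\<in>UNIV. \<bar>h $ i\<bar>)"
      by simp
    moreover have "p UNIV = h" by (simp add: vec_eq_iff p_nth)
    moreover have "(\<Sum>i\<in>UNIV. \<bar>h $ i\<bar>) \<le> real CARD('n) * norm h"
      by (rule order_trans[OF sum_bounded_above[of _ _ "norm h"]]) (auto simp: component_le_norm_cart)
    then have "e' * (\<Sum>i\<in>UNIV. \<bar>h $ i\<bar>) \<le> e * norm h"
      using mult_left_mono[of "\<Sum>i\<in>UNIV. \<bar>h $ i\<bar>" "real CARD('n) * norm h" e'] e' by (simp add: e'_def)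
    ultimately show "norm (u y - u x - (\<Sum>i\<in>UNIV. D i x * (y - x) $ i)) \<le> e * norm (y - x)"
      by (simp add: h_def)
  qed
qed

text \<open>The second difference over a square is the difference of one function over a side, so two applications of
  the mean value theorem write it as a value of a mixed derivative. The second difference is symmetric in the two
  directions, and this is what forces the mixed derivatives to commute.\<close>

lemma mixed_difference_mvt:
  fixes u :: "real ^ 'n \<Rightarrow> real"
  assumes part: "\<And>i y. y \<in> S \<Longrightarrow> has_partial i u (D i y) y"
    and part2: "\<And>i j y. y \<in> S \<Longrightarrow> has_partial i (D j) (DD i j y) y"
    and S: "\<And>p q. p \<in> {0..s} \<Longrightarrow> q \<in> {0..s} \<Longrightarrow> x + p *\<^sub>R axis i 1 + q *\<^sub>R axis j 1 \<in> S"
    and s: "s \<ge> 0"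
  obtains p q where "p \<in> {0..s}" "q \<in> {0..s}"
    "u (x + s *\<^sub>R axis i 1 + s *\<^sub>R axis j 1) - u (x + s *\<^sub>R axis i 1) - u (x + s *\<^sub>R axis j 1) + u x
      = s\<^sup>2 * DD j i (x + p *\<^sub>R axis i 1 + q *\<^sub>R axis j 1)"
proof -
  let ?ei = "axis i 1 :: real ^ 'n" and ?ej = "axis j 1 :: real ^ 'n"
  have rs: "r * s \<in> {0..s}" if "r \<in> {0..1}" for r
    using that s by (simp add: mult_left_le_one_le)
  define v where "v y = u (y + s *\<^sub>R ?ej) - u y" for y
  have dv: "has_partial i v (D i (x + (r * s) *\<^sub>R ?ei + s *\<^sub>R ?ej) - D i (x + (r * s) *\<^sub>R ?ei)) (x + (r * s) *\<^sub>R ?ei)"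
    if "r \<in> {0..1}" for r
    using part[OF S[OF rs[OF that], of s], of i] part[OF S[OF rs[OF that], of 0], of i] s
    unfolding has_partial_def v_def
    by (auto intro!: derivative_eq_intros simp: algebra_simps)
  obtain \<theta> where \<theta>: "\<theta> \<in> {0..1}"
    and 1: "v (x + s *\<^sub>R ?ei) - v x = s * (D i (x + (\<theta> * s) *\<^sub>R ?ei + s *\<^sub>R ?ej) - D i (x + (\<theta> * s) *\<^sub>R ?ei))"
    by (rule partial_mvt[of i v "\<lambda>y. D i (y + s *\<^sub>R ?ej) - D i y" x s]) (use dv in auto)
  obtain \<eta> where \<eta>: "\<eta> \<in> {0..1}"
    and 2: "D i (x + (\<theta> * s) *\<^sub>R ?ei + s *\<^sub>R ?ej) - D i (x + (\<theta> * s) *\<^sub>R ?ei)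
      = s * DD j i (x + (\<theta> * s) *\<^sub>R ?ei + (\<eta> * s) *\<^sub>R ?ej)"
    by (rule partial_mvt[of j "D i" "DD j i" "x + (\<theta> * s) *\<^sub>R ?ei" s])
      (use part2 S rs \<theta> in auto)
  show thesis
    by (rule that[OF rs[OF \<theta>] rs[OF \<eta>]]) (use 1 2 in \<open>simp add: v_def power2_eq_square algebra_simps\<close>)
qed

lemma mixed_partials_commute:
  fixes u :: "real ^ 'n \<Rightarrow> real"
  assumes S: "open S" "x \<in> S"
    and part: "\<And>i y. y \<in> S \<Longrightarrow> has_partial i u (D i y) y"
    and part2: "\<And>i j y. y \<in> S \<Longrightarrow> has_partial i (D j) (DD i j y) y"
    and cont: "\<And>i j. continuous_on S (DD i j)"
  shows "DD i j x = DD j i x"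
proof -
  have close: "\<bar>DD i j x - DD j i x\<bar> \<le> e" if e: "e > 0" for e
  proof -
    have "\<forall>\<^sub>F y in at x. y \<in> S \<and> \<bar>DD i j y - DD i j x\<bar> < e / 2 \<and> \<bar>DD j i y - DD j i x\<bar> < e / 2"
    proof -
      have "\<forall>\<^sub>F y in at x. \<bar>DD k l y - DD k l x\<bar> < e / 2" for k l
        using cont[of k l] S tendstoD[of "DD k l" "DD k l x" "at x" "e / 2"] e
        by (simp add: continuous_on_eq_continuous_at isCont_def dist_real_def)
      then show ?thesis
        using eventually_at_in_open'[OF S] by (intro eventually_conj) auto
    qed
    then obtain r where r: "r > 0" and near':
      "\<And>y. y \<noteq> x \<Longrightarrow> dist y x < r \<Longrightarrow> y \<in> S \<and> \<bar>DD i j y - DD i j x\<bar> < e / 2 \<and> \<bar>DD j i y - DD j i x\<bar> < e / 2"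
      unfolding eventually_at by auto
    have near: "y \<in> S \<and> \<bar>DD i j y - DD i j x\<bar> < e / 2 \<and> \<bar>DD j i y - DD j i x\<bar> < e / 2"
      if "norm (y - x) < r" for y
      using near'[of y] that S e by (cases "y = x") (auto simp: dist_norm)
    define s where "s = r / 3"
    have s: "s > 0" using r by (simp add: s_def)
    have small: "norm (p *\<^sub>R axis k 1 + q *\<^sub>R axis l (1::real)) < r"
      if "p \<in> {0..s}" "q \<in> {0..s}" for p q and k l :: 'n
      using that r norm_triangle_ineq[of "p *\<^sub>R axis k 1" "q *\<^sub>R axis l (1::real)"] by (simp add: s_def)
    have nearpq: "x + p *\<^sub>R axis k 1 + q *\<^sub>R axis l 1 \<in> S"
      "\<bar>DD i j (x + p *\<^sub>R axis k 1 + q *\<^sub>R axis l 1) - DD i j x\<bar> < e / 2"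
      "\<bar>DD j i (x + p *\<^sub>R axis k 1 + q *\<^sub>R axis l 1) - DD j i x\<bar> < e / 2"
      if "p \<in> {0..s}" "q \<in> {0..s}" for p q k l
      using near[of "x + p *\<^sub>R axis k 1 + q *\<^sub>R axis l 1"] small[OF that, of k l]
      by (auto simp: algebra_simps)
    obtain p q where pq: "p \<in> {0..s}" "q \<in> {0..s}"
      "u (x + s *\<^sub>R axis i 1 + s *\<^sub>R axis j 1) - u (x + s *\<^sub>R axis i 1) - u (x + s *\<^sub>R axis j 1) + u x
      = s\<^sup>2 * DD j i (x + p *\<^sub>R axis i 1 + q *\<^sub>R axis j 1)"
      by (rule mixed_difference_mvt[of S u D DD s x i j]) (use part part2 nearpq s in auto)
    obtain p' q' where pq': "p' \<in> {0..s}" "q' \<in> {0..s}"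
      "u (x + s *\<^sub>R axis j 1 + s *\<^sub>R axis i 1) - u (x + s *\<^sub>R axis j 1) - u (x + s *\<^sub>R axis i 1) + u x
      = s\<^sup>2 * DD i j (x + p' *\<^sub>R axis j 1 + q' *\<^sub>R axis i 1)"
      by (rule mixed_difference_mvt[of S u D DD s x j i]) (use part part2 nearpq s in auto)
    \<comment> \<open>Both mixed derivatives, at two nearby points, equal the same difference quotient.\<close>
    have "s\<^sup>2 * DD j i (x + p *\<^sub>R axis i 1 + q *\<^sub>R axis j 1) = s\<^sup>2 * DD i j (x + p' *\<^sub>R axis j 1 + q' *\<^sub>R axis i 1)"
    proof -
      have "x + s *\<^sub>R axis j 1 + s *\<^sub>R axis i 1 = x + s *\<^sub>R axis i 1 + s *\<^sub>R axis j 1"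
        by (simp add: add_ac)
      from pq'(3)[unfolded this] pq(3) show ?thesis by linarith
    qed
    then have "DD j i (x + p *\<^sub>R axis i 1 + q *\<^sub>R axis j 1) = DD i j (x + p' *\<^sub>R axis j 1 + q' *\<^sub>R axis i 1)"
      using s by simp
    then show ?thesis
      using nearpq(3)[OF pq(1,2), of i j] nearpq(2)[OF pq'(1,2), of j i] by linarith
  qed
  then have "\<bar>DD i j x - DD j i x\<bar> \<le> 0" by (rule field_le_epsilon[where y = 0, simplified])
  then show ?thesis by simp
qed

text \<open>Along the line \<open>s \<mapsto> x + s h\<close> the function has first derivative \<open>0\<close> and second derivative equal to
  the Hessian form at \<open>h\<close>. If that were positive, the first derivative would be positive for small positive \<open>s\<close>
  and the function would rise above its maximum.\<close>

lemma local_max_gradient_hessian: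
  fixes u :: "real ^ 'n \<Rightarrow> real"
  assumes S: "open S" "x \<in> S"
    and part: "\<And>i y. y \<in> S \<Longrightarrow> has_partial i u (D i y) y"
    and part2: "\<And>i j y. y \<in> S \<Longrightarrow> has_partial i (D j) (DD i j y) y"
    and cont: "\<And>i. continuous_on S (D i)"
    and cont2: "\<And>i j. continuous_on S (DD i j)"
    and max: "\<And>y. y \<in> S \<Longrightarrow> u y \<le> u x"
  shows "D i x = 0" "(\<Sum>i\<in>UNIV. \<Sum>j\<in>UNIV. DD i j x * h $ i * h $ j) \<le> 0"
proof -
  have grad: "D i x = 0" for i
  proof -
    have "(\<lambda>r. x + r *\<^sub>R axis i 1) \<midarrow>0\<rightarrow> x + 0 *\<^sub>R axis i 1" by (intro tendsto_intros)
    then have "\<forall>\<^sub>F r in at 0. x + r *\<^sub>R axis i 1 \<in> S"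
      using S by (auto dest!: topological_tendstoD)
    then obtain d where d: "d > 0" "\<And>r. r \<noteq> 0 \<Longrightarrow> \<bar>r\<bar> < d \<Longrightarrow> x + r *\<^sub>R axis i 1 \<in> S"
      unfolding eventually_at by auto
    have inS: "x + r *\<^sub>R axis i 1 \<in> S" if "\<bar>r\<bar> < d" for r
      using d(2)[of r] that S by (cases "r = 0") auto
    show ?thesis
      by (rule DERIV_local_max[of "\<lambda>r. u (x + r *\<^sub>R axis i 1)" _ 0 d])
        (use d(1) part[OF S(2), of i] inS max in \<open>auto simp: has_partial_def\<close>)
  qed
  then show "D i x = 0" .
  define g where "g s = (\<Sum>j\<in>UNIV. D j (x + s *\<^sub>R h) * h $ j)" for s
  have du: "((\<lambda>s. u (x + s *\<^sub>R h)) has_real_derivative g s) (at s)" if "x + s *\<^sub>R h \<in> S" for s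
  proof -
    have 1: "((\<lambda>s. x + s *\<^sub>R h) has_derivative (\<lambda>t. t *\<^sub>R h)) (at s)"
      by (auto intro!: derivative_eq_intros)
    show ?thesis
      unfolding has_field_derivative_def
      by (rule has_derivative_eq_rhs[OF has_derivative_compose[OF 1
            continuous_partials_imp_has_derivative[OF S(1) that part cont]]])
        (auto simp: g_def sum_distrib_right sum_distrib_left fun_eq_iff mult_ac)
  qed
  have dD: "((\<lambda>s. D j (x + s *\<^sub>R h)) has_real_derivative (\<Sum>i\<in>UNIV. DD i j x * h $ i)) (at 0)" for j
  proof -
    have 1: "((\<lambda>s. x + s *\<^sub>R h) has_derivative (\<lambda>t. t *\<^sub>R h)) (at 0)"
      by (auto intro!: derivative_eq_intros)
    have 2: "(D j has_derivative (\<lambda>h. \<Sum>i\<in>UNIV. DD i j x * h $ i)) (at (x + 0 *\<^sub>R h))"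
      using continuous_partials_imp_has_derivative[OF S, of "D j" "\<lambda>i. DD i j"] part2 cont2 by simp
    show ?thesis
      unfolding has_field_derivative_def
      by (rule has_derivative_eq_rhs[OF has_derivative_compose[OF 1 2]])
        (auto simp: sum_distrib_right sum_distrib_left fun_eq_iff mult_ac)
  qed
  define Q where "Q = (\<Sum>i\<in>UNIV. \<Sum>j\<in>UNIV. DD i j x * h $ i * h $ j)"
  have dg: "(g has_real_derivative Q) (at 0)"
    unfolding g_def
  proof (rule DERIV_cong[OF DERIV_sum[OF DERIV_cmult_right[OF dD]]])
    show "(\<Sum>j\<in>UNIV. (\<Sum>i\<in>UNIV. DD i j x * h $ i) * h $ j) = Q"
      unfolding Q_def sum_distrib_right by (rule sum.swap)
  qed
  have "Q \<le> 0"
  proof (rule ccontr)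
    assume "\<not> Q \<le> 0"
    then obtain d1 where d1: "d1 > 0" "\<And>s. 0 < s \<Longrightarrow> s < d1 \<Longrightarrow> g 0 < g s"
      using DERIV_pos_inc_right[OF dg] by auto
    have "(\<lambda>s. x + s *\<^sub>R h) \<midarrow>0\<rightarrow> x + 0 *\<^sub>R h" by (intro tendsto_intros)
    then have "\<forall>\<^sub>F s in at 0. x + s *\<^sub>R h \<in> S"
      using S by (auto dest!: topological_tendstoD)
    then obtain d2 where d2: "d2 > 0" "\<And>s. s \<noteq> 0 \<Longrightarrow> \<bar>s\<bar> < d2 \<Longrightarrow> x + s *\<^sub>R h \<in> S"
      unfolding eventually_at by auto
    have inS: "x + s *\<^sub>R h \<in> S" if "\<bar>s\<bar> < d2" for s
      using d2(2)[of s] that S by (cases "s = 0") auto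
    define s where "s = min d1 d2 / 2"
    have s: "0 < s" "s < d1" "s < d2" using d1 d2 by (auto simp: s_def)
    obtain z where z: "0 < z" "z < s" "u (x + s *\<^sub>R h) - u (x + 0 *\<^sub>R h) = (s - 0) * g z"
      using MVT2[OF s(1), of "\<lambda>s. u (x + s *\<^sub>R h)" g] du inS s by auto
    have "g 0 = 0" by (simp add: g_def grad)
    then have "g z > 0" using d1(2)[of z] z s by simp
    then have "s * g z > 0" using s by simp
    then have "u (x + s *\<^sub>R h) > u x" using z(3) by simp
    with max[OF inS[of s]] s show False by simp
  qed
  then show "(\<Sum>i\<in>UNIV. \<Sum>j\<in>UNIV. DD i j x * h $ i * h $ j) \<le> 0" by (simp add: Q_def)
qed

section \<open>The trace inequality for elliptic operators\<close>

lemma quadratic_form_add_axis: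
  fixes D :: "'n::finite \<Rightarrow> 'n \<Rightarrow> real" and x :: "real ^ 'n"
  assumes sym: "\<And>i j. D i j = D j i"
  shows "(\<Sum>i\<in>UNIV. \<Sum>j\<in>UNIV. D i j * (x + c *\<^sub>R axis k 1) $ i * (x + c *\<^sub>R axis k 1) $ j)
    = (\<Sum>i\<in>UNIV. \<Sum>j\<in>UNIV. D i j * x $ i * x $ j) + 2 * c * (\<Sum>j\<in>UNIV. D k j * x $ j) + c\<^sup>2 * D k k"
proof -
  have split: "D i j * (x + c *\<^sub>R axis k 1) $ i * (x + c *\<^sub>R axis k 1) $ j
    = D i j * x $ i * x $ j + (if i = k then c * (D k j * x $ j) else 0)
      + (if j = k then c * (D k i * x $ i) else 0)
      + (if i = k then (if j = k then c\<^sup>2 * D k k else 0) else 0)" for i j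
    using sym[of i k] by (auto simp: axis_def algebra_simps power2_eq_square)
  have if_out: "(\<Sum>j\<in>(UNIV::'n set). if P then F j else 0) = (if P then \<Sum>j\<in>UNIV. F j else 0)"
    for P and F :: "'n \<Rightarrow> real" by simp
  show ?thesis
    unfolding split sum.distrib if_out by (simp add: sum_distrib_left[symmetric])
qed

text \<open>The Frobenius product of two positive semidefinite matrices is nonnegative because one of them, here the
  symmetric \<open>D\<close>, is a sum of matrices \<open>v v\<^sup>T\<close>, and the product of the other with \<open>v v\<^sup>T\<close> is its quadratic
  form at \<open>v\<close>. The decomposition is Gaussian elimination: each step splits off the rank-one matrix built from a row
  with a positive diagonal entry and leaves a Schur complement with one row and column fewer. A row with diagonal
  entry \<open>0\<close> vanishes altogether.\<close>

lemma frobenius_product_nonneg: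
  fixes a D :: "'n::finite \<Rightarrow> 'n \<Rightarrow> real"
  assumes a: "\<And>x :: real ^ 'n. 0 \<le> (\<Sum>i\<in>UNIV. \<Sum>j\<in>UNIV. a i j * x $ i * x $ j)"
    and sym: "\<And>i j. D i j = D j i"
    and D: "\<And>x :: real ^ 'n. 0 \<le> (\<Sum>i\<in>UNIV. \<Sum>j\<in>UNIV. D i j * x $ i * x $ j)"
  shows "0 \<le> (\<Sum>i\<in>UNIV. \<Sum>j\<in>UNIV. a i j * D i j)"
proof -
  have "0 \<le> (\<Sum>i\<in>UNIV. \<Sum>j\<in>UNIV. a i j * D i j)"
    if "finite S" and "\<And>i j. D i j = D j i"
      and "\<And>x :: real ^ 'n. 0 \<le> (\<Sum>i\<in>UNIV. \<Sum>j\<in>UNIV. D i j * x $ i * x $ j)"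
      and "\<And>i j. i \<notin> S \<Longrightarrow> D i j = 0" for S and D :: "'n \<Rightarrow> 'n \<Rightarrow> real"
    using that
  proof (induction S arbitrary: D rule: finite_induct)
    case empty then show ?case by simp
  next
    case (insert k S)
    note sym = insert.prems(1) and psd = insert.prems(2) and supp = insert.prems(3)
    note expand = quadratic_form_add_axis[of D, OF sym]
    show ?case
    proof (cases "D k k = 0")
      case True
      have row: "D k j = 0" for j
      proof (rule ccontr)
        assume nz: "D k j \<noteq> 0"
        \<comment> \<open>With a zero diagonal entry the form is affine in \<open>c\<close>; this \<open>c\<close> makes it \<open>-1\<close>.\<close>
        define c where "c = - (D j j + 1) / (2 * D k j)"
        have "(\<Sum>i\<in>UNIV. \<Sum>l\<in>UNIV. D i l * axis j (1::real) $ i * axis j (1::real) $ l) = D j j"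
          using expand[of 0 1 j] by simp
        moreover have "(\<Sum>i\<in>UNIV. D k i * axis j (1::real) $ i) = D k j"
          by (simp add: axis_def if_distrib[of "(*) _"] cong: if_cong)
        ultimately have "0 \<le> D j j + 2 * c * D k j"
          using psd[of "axis j 1 + c *\<^sub>R axis k 1"] True expand[of "axis j 1" c k] by simp
        also have "\<dots> = -1" using nz by (simp add: c_def field_simps)
        finally show False by simp
      qed
      have "D i j = 0" if "i \<notin> S" for i j
        using that supp[of i j] row[of j] by (cases "i = k") auto
      then show ?thesis
        by (rule insert.IH[OF sym psd])
    next
      case False
      have "(\<Sum>i\<in>UNIV. \<Sum>l\<in>UNIV. D i l * axis k (1::real) $ i * axis k (1::real) $ l) = D k k"
        using expand[of 0 1 k] by simp
      then have pos: "D k k > 0" using psd[of "axis k 1"] False by simp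
      define D' where "D' i j = D i j - D k i * D k j / D k k" for i j
      have "0 \<le> (\<Sum>i\<in>UNIV. \<Sum>j\<in>UNIV. a i j * D' i j)"
      proof (rule insert.IH)
        show "D' i j = D' j i" for i j by (simp add: D'_def sym[of i j])
        show "D' i j = 0" if "i \<notin> S" for i j
        proof (cases "i = k")
          case False
          then have z: "i \<notin> insert k S" using that by simp
          have "D i j = 0" "D k i = 0" using supp[OF z] sym[of k i] by auto
          then show ?thesis by (simp add: D'_def)
        qed (use pos in \<open>simp add: D'_def\<close>)
        fix x :: "real ^ 'n"
        define s where "s = (\<Sum>j\<in>UNIV. D k j * x $ j)"
        have "(\<Sum>i\<in>UNIV. \<Sum>j\<in>UNIV. D k i * D k j / D k k * x $ i * x $ j) = s\<^sup>2 / D k k"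
          by (simp add: s_def power2_eq_square sum_product sum_divide_distrib mult_ac)
        then have "(\<Sum>i\<in>UNIV. \<Sum>j\<in>UNIV. D' i j * x $ i * x $ j)
            = (\<Sum>i\<in>UNIV. \<Sum>j\<in>UNIV. D i j * x $ i * x $ j) - s\<^sup>2 / D k k"
          by (simp add: D'_def left_diff_distrib sum_subtractf)
        \<comment> \<open>The Schur complement is the original form after minimisation over the \<open>k\<close>-th coordinate.\<close>
        also have "\<dots> = (\<Sum>i\<in>UNIV. \<Sum>j\<in>UNIV. D i j * x $ i * x $ j)
            + 2 * (- s / D k k) * s + (- s / D k k)\<^sup>2 * D k k"
          using pos by (simp add: power2_eq_square)
        also have "\<dots> \<ge> 0"
          using psd[of "x + (- s / D k k) *\<^sub>R axis k 1"] unfolding expand s_def .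
        finally show "0 \<le> (\<Sum>i\<in>UNIV. \<Sum>j\<in>UNIV. D' i j * x $ i * x $ j)" .
      qed
      moreover have "(\<Sum>i\<in>UNIV. \<Sum>j\<in>UNIV. a i j * D i j)
          = (\<Sum>i\<in>UNIV. \<Sum>j\<in>UNIV. a i j * D' i j)
            + (\<Sum>i\<in>UNIV. \<Sum>j\<in>UNIV. a i j * (\<chi> i. D k i) $ i * (\<chi> i. D k i) $ j) / D k k"
        by (simp add: D'_def right_diff_distrib sum_subtractf sum_divide_distrib mult_ac)
      ultimately show ?thesis
        using a[of "\<chi> i. D k i"] pos by simp
    qed
  qed
  from this[of UNIV D] show ?thesis using sym D by simp
qed

lemma elliptic_part_nonpos_at_max:
  fixes u :: "real ^ 'n \<Rightarrow> real"
  assumes "open S" "x \<in> S"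
    and "\<And>i y. y \<in> S \<Longrightarrow> has_partial i u (D i y) y"
    and "\<And>i j y. y \<in> S \<Longrightarrow> has_partial i (D j) (DD i j y) y"
    and "\<And>i. continuous_on S (D i)"
    and "\<And>i j. continuous_on S (DD i j)"
    and "\<And>y. y \<in> S \<Longrightarrow> u y \<le> u x"
    and a: "\<And>h :: real ^ 'n. 0 \<le> (\<Sum>i\<in>UNIV. \<Sum>j\<in>UNIV. a i j * h $ i * h $ j)"
  shows "(\<Sum>i\<in>UNIV. \<Sum>j\<in>UNIV. a i j * DD i j x) \<le> 0"
proof -
  have "0 \<le> (\<Sum>i\<in>UNIV. \<Sum>j\<in>UNIV. a i j * - DD i j x)"
  proof (rule frobenius_product_nonneg[OF a])
    show "- DD i j x = - DD j i x" for i j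
      using mixed_partials_commute[OF assms(1-4,6)] by simp
    show "0 \<le> (\<Sum>i\<in>UNIV. \<Sum>j\<in>UNIV. - DD i j x * h $ i * h $ j)" for h
      using local_max_gradient_hessian(2)[OF assms(1-7), of h] by (simp add: sum_negf)
  qed
  then show ?thesis by (simp add: sum_negf)
qed

section \<open>Time derivatives\<close>

text \<open>Difference quotients towards earlier times are nonnegative at a maximum. They alone determine the one-sided
  derivative at the final time, so no equality can be expected there.\<close>

lemma derivative_nonneg_at_left_max:
  fixes g :: "real \<Rightarrow> real"
  assumes der: "(g has_real_derivative d) (at t within {0<..T})" and t: "t \<in> {0<..T}"
    and max: "\<And>s. s \<in> {0<..T} \<Longrightarrow> g s \<le> g t"
  shows "d \<ge> 0"
proof (rule ccontr)
  assume "\<not> d \<ge> 0"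
  then obtain e where e: "e > 0" "\<And>h. h > 0 \<Longrightarrow> t - h \<in> {0<..T} \<Longrightarrow> h < e \<Longrightarrow> g t < g (t - h)"
    using has_real_derivative_neg_dec_left[OF der] by auto
  define h where "h = min e t / 2"
  have "h > 0" "h < e" "t - h \<in> {0<..T}" using e t by (auto simp: h_def min_def)
  then show False using e(2)[of h] max[of "t - h"] by simp
qed

section \<open>Bounds for the nonlocal term\<close>

text \<open>The substitution \<open>y \<mapsto> x - y\<close> turns integrals of the kernel against functions of \<open>y\<close> into
  moments of the kernel. The kernel is only Lebesgue measurable, so invariance has to be known for the completed measure.\<close>

lemma
  fixes x :: "'a::euclidean_space"
  shows lebesgue_measurable_reflect: "(\<lambda>y. x - y) \<in> lebesgue \<rightarrow>\<^sub>M lebesgue"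
    and distr_lebesgue_reflect: "distr lebesgue lebesgue (\<lambda>y. x - y) = (lebesgue :: 'a measure)"
proof -
  have eq: "(\<lambda>y. x + (\<Sum>j\<in>Basis. (- 1 * (y \<bullet> j)) *\<^sub>R j)) = (\<lambda>y. x - y)"
    by (simp add: sum_negf euclidean_representation fun_eq_iff)
  show "(\<lambda>y. x - y) \<in> lebesgue \<rightarrow>\<^sub>M lebesgue"
    using lebesgue_affine_measurable[of "\<lambda>_. -1" x] unfolding eq by simp
  show "distr lebesgue lebesgue (\<lambda>y. x - y) = (lebesgue :: 'a measure)"
    using lebesgue_affine_euclidean[of "\<lambda>_. -1" x] unfolding eq by (simp add: density_1)
qed

lemma
  fixes f :: "'a::euclidean_space \<Rightarrow> real"
  assumes f: "integrable lebesgue f"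
  shows integrable_lebesgue_reflect: "integrable lebesgue (\<lambda>y. f (x - y))"
    and integral_lebesgue_reflect: "(LINT y|lebesgue. f (x - y)) = (LINT y|lebesgue. f y)"
proof -
  have "integrable (distr lebesgue lebesgue (\<lambda>y. x - y)) f"
    using f by (simp only: distr_lebesgue_reflect)
  then show "integrable lebesgue (\<lambda>y. f (x - y))"
    by (rule integrable_distr[OF lebesgue_measurable_reflect])
  have "(LINT y|distr lebesgue lebesgue (\<lambda>y. x - y). f y) = (LINT y|lebesgue. f (x - y))"
    using f by (intro integral_distr lebesgue_measurable_reflect borel_measurable_integrable)
  then show "(LINT y|lebesgue. f (x - y)) = (LINT y|lebesgue. f y)"
    by (simp only: distr_lebesgue_reflect)
qed

lemma set_integrable_kernel:
  fixes \<phi> g :: "'a::euclidean_space \<Rightarrow> real"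
  assumes \<phi>: "integrable lebesgue \<phi>" and \<Omega>: "open \<Omega>"
    and g: "continuous_on \<Omega> g" "\<And>y. y \<in> \<Omega> \<Longrightarrow> \<bar>g y\<bar> \<le> M"
  shows "set_integrable lebesgue \<Omega> (\<lambda>y. \<phi> (x - y) * g y)"
  unfolding set_integrable_def
proof (rule Bochner_Integration.integrable_bound)
  show "integrable lebesgue (\<lambda>y. M * \<phi> (x - y))"
    using integrable_lebesgue_reflect[OF \<phi>] by simp
  have "(\<lambda>y. indicator \<Omega> y *\<^sub>R g y) \<in> borel_measurable lebesgue"
    using borel_measurable_continuous_on_indicator[OF _ g(1)] \<Omega>
    by (intro measurable_completion) (simp add: measurable_lborel1)
  moreover have "(\<lambda>y. \<phi> (x - y)) \<in> borel_measurable lebesgue"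
    using integrable_lebesgue_reflect[OF \<phi>] by (rule borel_measurable_integrable)
  ultimately have "(\<lambda>y. \<phi> (x - y) * (indicator \<Omega> y *\<^sub>R g y)) \<in> borel_measurable lebesgue"
    by (rule borel_measurable_times[rotated])
  then show "(\<lambda>y. indicator \<Omega> y *\<^sub>R (\<phi> (x - y) * g y)) \<in> borel_measurable lebesgue"
    by (simp add: mult_ac)
  have "\<bar>indicator \<Omega> y * (\<phi> (x - y) * g y)\<bar> \<le> \<bar>M * \<phi> (x - y)\<bar>" for y
    using g(2)[of y] by (auto simp: indicator_def abs_mult mult.commute intro!: mult_right_mono)
  then show "AE y in lebesgue. norm (indicator \<Omega> y *\<^sub>R (\<phi> (x - y) * g y)) \<le> norm (M * \<phi> (x - y))"
    by simp
qed

lemma kernel_integral_bounded: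
  fixes \<phi> g :: "'a::euclidean_space \<Rightarrow> real"
  assumes \<phi>: "integrable lebesgue \<phi>" "\<And>x. \<phi> x \<ge> 0" and \<Omega>: "open \<Omega>"
    and g: "continuous_on \<Omega> g" "\<And>y. y \<in> \<Omega> \<Longrightarrow> \<bar>g y\<bar> \<le> M" and M: "M \<ge> 0"
  shows "\<bar>LINT y:\<Omega>|lebesgue. \<phi> (x - y) * g y\<bar> \<le> M * (LINT y|lebesgue. \<phi> y)"
proof -
  have "\<bar>LINT y:\<Omega>|lebesgue. \<phi> (x - y) * g y\<bar> \<le> (LINT y|lebesgue. M * \<phi> (x - y))"
    unfolding set_lebesgue_integral_def real_norm_def[symmetric]
  proof (rule Bochner_Integration.integral_norm_bound_integral)
    show "integrable lebesgue (\<lambda>y. indicator \<Omega> y *\<^sub>R (\<phi> (x - y) * g y))"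
      using set_integrable_kernel[OF \<phi>(1) \<Omega> g] by (simp add: set_integrable_def)
    show "integrable lebesgue (\<lambda>y. M * \<phi> (x - y))"
      using integrable_lebesgue_reflect[OF \<phi>(1)] by simp
    show "norm (indicator \<Omega> y *\<^sub>R (\<phi> (x - y) * g y)) \<le> M * \<phi> (x - y)" for y
      using g(2)[of y] \<phi>(2)[of "x - y"] M
      by (auto simp: indicator_def abs_mult mult.commute intro!: mult_right_mono)
  qed
  then show ?thesis by (simp add: integral_lebesgue_reflect[OF \<phi>(1)])
qed

text \<open>The second moment of the kernel enters here: since \<open>\<bar>y\<bar> \<le> \<bar>x\<bar> + \<bar>x - y\<bar>\<close>, the weight \<open>1 + \<bar>y\<bar>\<^sup>2\<close> is at
  most \<open>(1 + \<bar>x\<bar>\<^sup>2) (2 + 2 \<bar>x - y\<bar>\<^sup>2)\<close>. Hence the nonlocal operator maps functions below a multiple of \<open>1 + \<bar>x\<bar>\<^sup>2\<close>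
  to functions below a multiple of the same weight, and the barrier survives it.\<close>

lemma kernel_integral_le_quadratic:
  fixes \<phi> g :: "'a::euclidean_space \<Rightarrow> real"
  assumes \<phi>: "integrable lebesgue \<phi>" "\<And>x. \<phi> x \<ge> 0"
    and \<psi>: "integrable lebesgue (\<lambda>x. \<phi> x * (norm x)\<^sup>2)" and \<Omega>: "open \<Omega>"
    and g: "continuous_on \<Omega> g" "\<And>y. y \<in> \<Omega> \<Longrightarrow> \<bar>g y\<bar> \<le> M"
    and le: "\<And>y. y \<in> \<Omega> \<Longrightarrow> g y \<le> c * (1 + (norm y)\<^sup>2)" and c: "c \<ge> 0"
  shows "(LINT y:\<Omega>|lebesgue. \<phi> (x - y) * g y)
    \<le> c * (1 + (norm x)\<^sup>2) * (LINT y|lebesgue. \<phi> y * (2 + 2 * (norm y)\<^sup>2))"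
proof -
  let ?\<Phi> = "\<lambda>y. \<phi> y * (2 + 2 * (norm y)\<^sup>2)"
  have \<Phi>: "integrable lebesgue ?\<Phi>"
  proof -
    have "integrable lebesgue (\<lambda>y. 2 * \<phi> y + 2 * (\<phi> y * (norm y)\<^sup>2))" using \<phi> \<psi> by simp
    then show ?thesis by (simp add: algebra_simps)
  qed
  have "(LINT y:\<Omega>|lebesgue. \<phi> (x - y) * g y) \<le> (LINT y|lebesgue. c * (1 + (norm x)\<^sup>2) * ?\<Phi> (x - y))"
    unfolding set_lebesgue_integral_def
  proof (rule integral_mono)
    show "integrable lebesgue (\<lambda>y. indicator \<Omega> y *\<^sub>R (\<phi> (x - y) * g y))"
      using set_integrable_kernel[OF \<phi>(1) \<Omega> g] by (simp add: set_integrable_def)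
    show "integrable lebesgue (\<lambda>y. c * (1 + (norm x)\<^sup>2) * ?\<Phi> (x - y))"
      using integrable_lebesgue_reflect[OF \<Phi>] by (rule integrable_mult_right)
    fix y
    have split: "1 + (norm y)\<^sup>2 \<le> (1 + (norm x)\<^sup>2) * (2 + 2 * (norm (x - y))\<^sup>2)"
    proof -
      have "norm y \<le> norm x + norm (x - y)"
        using norm_triangle_ineq4[of x "x - y"] by simp
      then have "(norm y)\<^sup>2 \<le> (norm x + norm (x - y))\<^sup>2" by (simp add: power_mono)
      also have "\<dots> \<le> 2 * (norm x)\<^sup>2 + 2 * (norm (x - y))\<^sup>2"
        using zero_le_power2[of "norm x - norm (x - y)"] by (simp add: power2_eq_square algebra_simps)
      finally have "1 + (norm y)\<^sup>2 \<le> 1 + (2 * (norm x)\<^sup>2 + 2 * (norm (x - y))\<^sup>2)" by simp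
      also have "\<dots> \<le> 1 + (2 * (norm x)\<^sup>2 + 2 * (norm (x - y))\<^sup>2) + (1 + 2 * ((norm x)\<^sup>2 * (norm (x - y))\<^sup>2))"
        by simp
      also have "\<dots> = (1 + (norm x)\<^sup>2) * (2 + 2 * (norm (x - y))\<^sup>2)" by (simp add: algebra_simps)
      finally show ?thesis .
    qed
    have nn: "0 \<le> c * (1 + (norm x)\<^sup>2) * ?\<Phi> (x - y)" using c \<phi>(2) by simp
    have "\<phi> (x - y) * g y \<le> c * (1 + (norm x)\<^sup>2) * ?\<Phi> (x - y)" if "y \<in> \<Omega>"
    proof -
      have "g y \<le> c * ((1 + (norm x)\<^sup>2) * (2 + 2 * (norm (x - y))\<^sup>2))"
        using le[OF that] mult_left_mono[OF split c] by linarith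
      from mult_left_mono[OF this \<phi>(2)[of "x - y"]] show ?thesis by (simp add: mult_ac)
    qed
    then show "indicator \<Omega> y *\<^sub>R (\<phi> (x - y) * g y) \<le> c * (1 + (norm x)\<^sup>2) * ?\<Phi> (x - y)"
      using nn by (simp add: indicator_def)
  qed
  also have "\<dots> = c * (1 + (norm x)\<^sup>2) * (LINT y|lebesgue. ?\<Phi> y)"
    by (simp only: integral_mult_right_zero integral_lebesgue_reflect[OF \<Phi>])
  finally show ?thesis .
qed

section \<open>Bounded solutions and the range of their values\<close>

text \<open>An essential bound of a continuous function is a bound, because a violation would persist on a nonempty open
  set. Infima and suprema over the closed cylinder are thereby those of bounded families.\<close>

lemma continuous_Linfty_bounded:
  fixes u :: "'a::euclidean_space \<Rightarrow> real"
  assumes U: "open U" and cont: "continuous_on (closure U) u" and L: "u \<in> Linfty (closure U)"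
  obtains M where "M \<ge> 0" "\<And>z. z \<in> closure U \<Longrightarrow> \<bar>u z\<bar> \<le> M"
proof -
  obtain M where "AE z in lebesgue_on (closure U). \<bar>u z\<bar> \<le> M"
    using L by (auto simp: Linfty_def)
  then have AE: "AE z in lebesgue. z \<in> closure U \<longrightarrow> \<bar>u z\<bar> \<le> M"
    by (simp add: AE_restrict_space_iff)
  have contU: "continuous_on U (\<lambda>z. \<bar>u z\<bar>)"
    using continuous_on_subset[OF cont closure_subset] by (intro continuous_intros)
  have "\<bar>u z\<bar> \<le> M" if z: "z \<in> U" for z
  proof (rule ccontr)
    assume "\<not> \<bar>u z\<bar> \<le> M"
    define V where "V = U \<inter> (\<lambda>z. \<bar>u z\<bar>) -` {M<..}"
    have "open V" unfolding V_def
      by (rule continuous_open_preimage[OF contU U]) simp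
    moreover have "V \<noteq> {}" using z \<open>\<not> \<bar>u z\<bar> \<le> M\<close> by (auto simp: V_def)
    moreover have "negligible V"
    proof -
      have "V \<subseteq> {z \<in> space lebesgue. \<not> (z \<in> closure U \<longrightarrow> \<bar>u z\<bar> \<le> M)}"
        using closure_subset by (force simp: V_def)
      moreover obtain N where N: "N \<in> null_sets lebesgue"
        "{z \<in> space lebesgue. \<not> (z \<in> closure U \<longrightarrow> \<bar>u z\<bar> \<le> M)} \<subseteq> N"
        using AE unfolding eventually_ae_filter by blast
      ultimately show ?thesis
        using negligible_subset negligible_iff_null_sets by (metis subset_trans)
    qed
    ultimately show False using open_not_negligible by blast
  qed
  then have "\<bar>u z\<bar> \<le> M" if "z \<in> closure U" for z
    using continuous_le_on_closure[of U "\<lambda>z. \<bar>u z\<bar>" z M] cont that by (auto intro: continuous_intros)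
  then show thesis by (intro that[of "\<bar>M\<bar>"]) (auto intro: order_trans[OF _ abs_ge_self])
qed

text \<open>The rectangle \<open>K\<close> contains all four mixed pairs of values of the two functions and of their nonlocal
  terms. This allows the arguments of the reaction term to be exchanged one after the other.\<close>

lemma K_set_memI:
  fixes ul uu :: "(real ^ 'n) \<times> real \<Rightarrow> real"
  assumes M: "\<And>z. z \<in> closure (cyl \<Omega> T) \<Longrightarrow> \<bar>ul z\<bar> \<le> M" "\<And>z. z \<in> closure (cyl \<Omega> T) \<Longrightarrow> \<bar>uu z\<bar> \<le> M"
    and N: "\<And>z. z \<in> closure (cyl \<Omega> T) \<Longrightarrow> \<bar>nonlocal \<Omega> \<phi> ul z\<bar> \<le> N"
      "\<And>z. z \<in> closure (cyl \<Omega> T) \<Longrightarrow> \<bar>nonlocal \<Omega> \<phi> uu z\<bar> \<le> N"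
    and z: "z \<in> closure (cyl \<Omega> T)"
    and p: "p = ul z \<or> p = uu z" and q: "q = nonlocal \<Omega> \<phi> ul z \<or> q = nonlocal \<Omega> \<phi> uu z"
  shows "(p, q) \<in> K_set \<Omega> T \<phi> ul uu"
proof -
  have range: "(INF z\<in>closure (cyl \<Omega> T). min (v z) (u z)) \<le> r \<and> r \<le> (SUP z\<in>closure (cyl \<Omega> T). max (v z) (u z))"
    if "\<And>z. z \<in> closure (cyl \<Omega> T) \<Longrightarrow> \<bar>u z\<bar> \<le> L" "\<And>z. z \<in> closure (cyl \<Omega> T) \<Longrightarrow> \<bar>v z\<bar> \<le> L"
      "r = u z \<or> r = v z" for u v :: "(real ^ 'n) \<times> real \<Rightarrow> real" and L r
  proof
    have "bdd_below ((\<lambda>z. min (v z) (u z)) ` closure (cyl \<Omega> T))"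
      by (rule bdd_belowI2[of _ "- L"]) (use that(1,2) in \<open>fastforce simp: min_def abs_le_iff\<close>)
    then show "(INF z\<in>closure (cyl \<Omega> T). min (v z) (u z)) \<le> r"
      by (rule cINF_lower2[OF _ z]) (use that(3) in auto)
    have "bdd_above ((\<lambda>z. max (v z) (u z)) ` closure (cyl \<Omega> T))"
      by (rule bdd_aboveI2[of _ _ L]) (use that(1,2) in \<open>fastforce simp: max_def abs_le_iff\<close>)
    then show "r \<le> (SUP z\<in>closure (cyl \<Omega> T). max (v z) (u z))"
      by (rule cSUP_upper2[OF _ z]) (use that(3) in auto)
  qed
  show ?thesis
    using range[of ul M uu p, OF M p] range[of "nonlocal \<Omega> \<phi> ul" N "nonlocal \<Omega> \<phi> uu" q, OF N q] by (simp add: K_set_def)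
qed

section \<open>Touching the barrier from below\<close>

lemma has_partial_quadratic: "has_partial i (\<lambda>y. 1 + (norm y)\<^sup>2) (2 * x $ i) x"
proof -
  have "1 + (norm (x + h *\<^sub>R axis i 1))\<^sup>2 = 1 + (norm x)\<^sup>2 + 2 * h * x $ i + h\<^sup>2" for h
    unfolding power2_norm_eq_inner
    using inner_commute[of "axis i 1" x]
    by (simp add: inner_add_left inner_add_right inner_axis power2_eq_square distrib_left)
  then show ?thesis
    unfolding has_partial_def by (auto intro!: derivative_eq_intros)
qed

lemma has_partial_component: "has_partial i (\<lambda>y. y $ j) (if i = j then 1 else 0) x"
  unfolding has_partial_def by (auto intro!: derivative_eq_intros simp: axis_def)

lemma has_partial_diff:
  "has_partial i u d x \<Longrightarrow> has_partial i v e x \<Longrightarrow> has_partial i (\<lambda>y. u y - v y) (d - e) x"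
  unfolding has_partial_def by (rule DERIV_diff)

lemma has_partial_cmult:
  "has_partial i u d x \<Longrightarrow> has_partial i (\<lambda>y. c * u y) (c * d) x"
  unfolding has_partial_def by (rule DERIV_cmult)

lemma has_partial_on_slice:
  assumes "has_partial_x_on i u D" "(x, t) \<in> D"
  shows "has_partial i (\<lambda>y. u (y, t)) (partial_x i u (x, t)) x"
  using assms unfolding has_partial_x_on_def has_partial_def partial_x_def
  by (auto simp: DERIV_deriv_iff_field_differentiable)

lemma has_partial_t_on_slice:
  assumes "has_partial_t_on T u D" "(x, t) \<in> D"
  shows "((\<lambda>s. u (x, s)) has_real_derivative partial_t T u (x, t)) (at t within {0<..T})"
  using assms unfolding has_partial_t_on_def partial_t_def
  by (auto simp: has_real_derivative_iff_has_vector_derivative vector_derivative_works)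

text \<open>A supersolution of the linearised problem once \<open>\<mu>\<close> is large: the coefficient bounds, and the second
  moment of the kernel, all cost at most a fixed multiple of \<open>1 + \<bar>x\<bar>\<^sup>2\<close>, and the time derivative gains the factor \<open>\<mu>\<close>.\<close>

definition barrier :: "real \<Rightarrow> (real ^ 'n) \<times> real \<Rightarrow> real" where
  "barrier \<mu> z = exp (\<mu> * snd z) * (1 + (norm (fst z))\<^sup>2)"

text \<open>On an unbounded set a bounded function need not attain its supremum, but the positive part of its quotient
  by the barrier tends to \<open>0\<close> at infinity, uniformly in time. Hence the quotient attains a positive maximum.\<close>

lemma touching_barrier:
  fixes w :: "(real ^ 'n) \<times> real \<Rightarrow> real"
  assumes C: "closed C" and cont: "continuous_on (C \<times> {0..T}) w"
    and M: "\<And>z. z \<in> C \<times> {0..T} \<Longrightarrow> w z \<le> M"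
    and \<mu>: "\<mu> \<ge> 0" and z1: "z1 \<in> C \<times> {0..T}" "w z1 > 0"
  obtains z m where "z \<in> C \<times> {0..T}" "m > 0" "w z = m * barrier \<mu> z"
    "\<And>z'. z' \<in> C \<times> {0..T} \<Longrightarrow> w z' \<le> m * barrier \<mu> z'"
proof -
  have pos: "barrier \<mu> z > 0" for z :: "(real ^ 'n) \<times> real"
    by (auto simp: barrier_def intro!: mult_pos_pos add_pos_nonneg)
  have ge: "barrier \<mu> (x, t) \<ge> 1 + (norm x)\<^sup>2" if "t \<ge> 0" for x :: "real ^ 'n" and t
    using mult_right_mono[of 1 "exp (\<mu> * t)" "1 + (norm x)\<^sup>2"] that \<mu> by (simp add: barrier_def)
  define \<epsilon> where "\<epsilon> = w z1 / barrier \<mu> z1"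
  have \<epsilon>: "\<epsilon> > 0" using z1 pos by (simp add: \<epsilon>_def)
  have M0: "M > 0" using M[OF z1(1)] z1(2) by linarith
  \<comment> \<open>Beyond this radius the quotient is below its value at \<open>z1\<close>.\<close>
  define R where "R = sqrt (M / \<epsilon>)"
  have far: "w (x, t) < \<epsilon> * barrier \<mu> (x, t)" if "(x, t) \<in> C \<times> {0..T}" "norm x > R" for x t
  proof -
    have "R \<ge> 0" using M0 \<epsilon> by (simp add: R_def)
    then have "M / \<epsilon> < (norm x)\<^sup>2"
      using power_strict_mono[OF that(2), of 2] M0 \<epsilon> by (simp add: R_def)
    also have "\<dots> < barrier \<mu> (x, t)" using ge[of t x] that by simp
    finally have "M < \<epsilon> * barrier \<mu> (x, t)" using \<epsilon> by (simp add: field_simps)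
    with M[OF that(1)] show ?thesis by linarith
  qed
  let ?K = "(C \<inter> cball 0 R) \<times> {0..T}"
  have "compact ?K" using C by (intro compact_Times closed_Int_compact) auto
  moreover have z1K: "z1 \<in> ?K"
    using z1 far[of "fst z1" "snd z1"] pos[of z1] by (cases z1) (force simp: \<epsilon>_def)
  moreover have "continuous_on ?K (\<lambda>z. w z / barrier \<mu> z)"
  proof (intro continuous_on_divide)
    show "continuous_on ?K w" using cont by (rule continuous_on_subset) auto
    show "continuous_on ?K (barrier \<mu>)" unfolding barrier_def by (intro continuous_intros)
    show "\<forall>z\<in>?K. barrier \<mu> z \<noteq> 0" using pos by (metis less_irrefl)
  qed
  ultimately obtain z where z: "z \<in> ?K"
    and max: "\<And>z'. z' \<in> ?K \<Longrightarrow> w z' / barrier \<mu> z' \<le> w z / barrier \<mu> z"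
    using continuous_attains_sup[of ?K "\<lambda>z. w z / barrier \<mu> z"] by blast
  define m where "m = w z / barrier \<mu> z"
  have m: "\<epsilon> \<le> m" using max[OF z1K] by (simp add: m_def \<epsilon>_def)
  show thesis
  proof (rule that[of z m])
    show "z \<in> C \<times> {0..T}" using z by auto
    show "m > 0" using m \<epsilon> by simp
    show "w z = m * barrier \<mu> z" using pos[of z] by (simp add: m_def)
    fix z' assume z': "z' \<in> C \<times> {0..T}"
    obtain x t where [simp]: "z' = (x, t)" by fastforce
    show "w z' \<le> m * barrier \<mu> z'"
    proof (cases "norm x \<le> R")
      case True
      then have "w z' / barrier \<mu> z' \<le> m" using z' by (auto simp: m_def intro!: max)
      then show ?thesis using pos[of z'] by (simp add: field_simps)
    next
      case False
      then have "w z' < \<epsilon> * barrier \<mu> z'" using far[of x t] z' by simp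
      also have "\<dots> \<le> m * barrier \<mu> z'" using m pos[of z'] by simp
      finally show ?thesis by simp
    qed
  qed
qed

text \<open>The parabolic boundary omits the lateral points at the initial and final times, which are
  limits of lateral points at intermediate times.\<close>

lemma nonpos_off_cyl:
  assumes T: "T > 0" and \<Omega>: "open \<Omega>" and cont: "continuous_on (closure (cyl \<Omega> T)) w"
    and bd: "\<And>z. z \<in> parabolic_boundary \<Omega> T \<Longrightarrow> w z \<le> (0::real)"
    and z: "z \<in> closure (cyl \<Omega> T)" "z \<notin> cyl \<Omega> T"
  shows "w z \<le> 0"
proof -
  obtain x t where [simp]: "z = (x, t)" by fastforce
  have x: "x \<in> closure \<Omega>" and t: "t \<in> {0..T}" using z T by (auto simp: closure_cyl)
  show ?thesis
  proof (cases "x \<in> \<Omega>")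
    case True
    then have "t = 0" using z t by (auto simp: cyl_def)
    then show ?thesis using bd True by (simp add: parabolic_boundary_def)
  next
    case False
    then have fr: "x \<in> frontier \<Omega>" using x \<Omega> by (simp add: frontier_def interior_open)
    have "continuous_on {0..T} (\<lambda>s. w (x, s))"
      by (rule continuous_on_compose2[OF cont]) (use T x in \<open>auto simp: closure_cyl intro!: continuous_intros\<close>)
    then show ?thesis
      using continuous_le_on_closure[of "{0<..<T}" "\<lambda>s. w (x, s)" t 0] T t fr bd
      by (simp add: parabolic_boundary_def)
  qed
qed

text \<open>At a point where the difference of \<open>u\<close> and \<open>v\<close> touches a multiple of the barrier from below, the gap is
  maximal in space and in time. So the difference and the multiple of the barrier have equal gradients, ordered Hessians and
  ordered time derivatives; the terms with \<open>m\<close> are the derivatives of that multiple.\<close>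

lemma derivatives_at_touching_point:
  fixes u v :: "(real ^ 'n) \<times> real \<Rightarrow> real" and a :: "'n \<Rightarrow> 'n \<Rightarrow> real"
  assumes \<Omega>: "open \<Omega>" and u: "u \<in> C21 \<Omega> T" and v: "v \<in> C21 \<Omega> T" and z: "(x, t) \<in> cyl \<Omega> T"
    and le: "\<forall>z\<in>cyl \<Omega> T. u z - v z \<le> m * barrier \<mu> z"
    and eq: "u (x, t) - v (x, t) = m * barrier \<mu> (x, t)"
  shows "partial_x i u (x, t) - partial_x i v (x, t) = m * exp (\<mu> * t) * (2 * x $ i)"
    and "(\<And>h :: real ^ 'n. 0 \<le> (\<Sum>i\<in>UNIV. \<Sum>j\<in>UNIV. a i j * h $ i * h $ j)) \<Longrightarrow>
      (\<Sum>i\<in>UNIV. \<Sum>j\<in>UNIV. a i j * partial_x i (partial_x j u) (x, t))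
        - (\<Sum>i\<in>UNIV. \<Sum>j\<in>UNIV. a i j * partial_x i (partial_x j v) (x, t))
      \<le> m * exp (\<mu> * t) * (2 * (\<Sum>i\<in>UNIV. a i i))"
    and "\<mu> * (m * barrier \<mu> (x, t)) \<le> partial_t T u (x, t) - partial_t T v (x, t)"
proof -
  have xt: "x \<in> \<Omega>" "t \<in> {0<..T}" using z by (auto simp: cyl_def)
  have in_cyl: "(y, t) \<in> cyl \<Omega> T" if "y \<in> \<Omega>" for y using that xt by (simp add: cyl_def)
  have slice: "continuous_on \<Omega> (\<lambda>y. g (y, t))" if "continuous_on (cyl \<Omega> T) g" for g :: "_ \<Rightarrow> real"
    by (rule continuous_on_compose2[OF that]) (auto intro!: continuous_intros in_cyl)
  define c where "c = m * exp (\<mu> * t)"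
  define g where "g y = u (y, t) - v (y, t) - c * (1 + (norm y)\<^sup>2)" for y
  define D where "D i y = partial_x i u (y, t) - partial_x i v (y, t) - c * (2 * y $ i)" for i y
  define DD where "DD i j y = partial_x i (partial_x j u) (y, t) - partial_x i (partial_x j v) (y, t)
    - c * (2 * (if i = j then 1 else 0))" for i j y
  have D: "has_partial i g (D i y) y" if "y \<in> \<Omega>" for i y
    unfolding g_def D_def
    using u v in_cyl[OF that]
    by (intro has_partial_diff has_partial_cmult has_partial_quadratic has_partial_on_slice)
      (auto simp: C21_def)
  have DD: "has_partial i (D j) (DD i j y) y" if "y \<in> \<Omega>" for i j y
    unfolding D_def[abs_def] DD_def
    using u v in_cyl[OF that]
    by (intro has_partial_diff has_partial_cmult has_partial_component has_partial_on_slice)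
      (auto simp: C21_def)
  have contD: "continuous_on \<Omega> (D i)" for i
    unfolding D_def[abs_def] using u v by (intro continuous_intros slice) (auto simp: C21_def)
  have contDD: "continuous_on \<Omega> (DD i j)" for i j
    unfolding DD_def[abs_def] using u v by (intro continuous_intros slice) (auto simp: C21_def)
  have max: "g y \<le> g x" if "y \<in> \<Omega>" for y
    using bspec[OF le in_cyl[OF that]] eq by (simp add: g_def c_def barrier_def)
  show "partial_x i u (x, t) - partial_x i v (x, t) = m * exp (\<mu> * t) * (2 * x $ i)"
    using local_max_gradient_hessian(1)[OF \<Omega> xt(1) D DD contD contDD max, of i]
    by (simp add: D_def c_def)
  show "(\<Sum>i\<in>UNIV. \<Sum>j\<in>UNIV. a i j * partial_x i (partial_x j u) (x, t))
        - (\<Sum>i\<in>UNIV. \<Sum>j\<in>UNIV. a i j * partial_x i (partial_x j v) (x, t))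
      \<le> m * exp (\<mu> * t) * (2 * (\<Sum>i\<in>UNIV. a i i))"
    if a: "\<And>h :: real ^ 'n. 0 \<le> (\<Sum>i\<in>UNIV. \<Sum>j\<in>UNIV. a i j * h $ i * h $ j)"
  proof -
    have "(\<Sum>i\<in>UNIV. \<Sum>j\<in>UNIV. a i j * DD i j x) \<le> 0"
      by (rule elliptic_part_nonpos_at_max[OF \<Omega> xt(1) D DD contD contDD max a])
    moreover have "(\<Sum>i\<in>UNIV. \<Sum>j\<in>UNIV. a i j * (c * (2 * (if i = j then 1 else 0)))) = c * (2 * (\<Sum>i\<in>UNIV. a i i))"
    proof -
      have "a i j * (c * (2 * (if i = j then 1 else 0))) = (if i = j then c * (2 * a i j) else 0)" for i j
        by simp
      then show ?thesis by (simp add: sum_distrib_left)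
    qed
    ultimately show ?thesis
      by (simp add: DD_def c_def right_diff_distrib sum_subtractf)
  qed
  have dt: "((\<lambda>s. u (x, s) - v (x, s) - m * barrier \<mu> (x, s)) has_real_derivative
      partial_t T u (x, t) - partial_t T v (x, t) - m * (exp (\<mu> * t) * \<mu> * (1 + (norm x)\<^sup>2))) (at t within {0<..T})"
    unfolding barrier_def fst_conv snd_conv
    by (intro DERIV_diff has_partial_t_on_slice[where D = "cyl \<Omega> T"])
      (use u v z in \<open>auto simp: C21_def intro!: derivative_eq_intros\<close>)
  have "0 \<le> partial_t T u (x, t) - partial_t T v (x, t) - m * (exp (\<mu> * t) * \<mu> * (1 + (norm x)\<^sup>2))"
  proof (rule derivative_nonneg_at_left_max[OF dt xt(2)])
    fix s assume "s \<in> {0<..T}"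
    then show "u (x, s) - v (x, s) - m * barrier \<mu> (x, s) \<le> u (x, t) - v (x, t) - m * barrier \<mu> (x, t)"
      using bspec[OF le, of "(x, s)"] eq xt by (simp add: cyl_def)
  qed
  then show "\<mu> * (m * barrier \<mu> (x, t)) \<le> partial_t T u (x, t) - partial_t T v (x, t)"
    by (simp add: barrier_def mult_ac)
qed

section \<open>The comparison principle\<close>

theorem theorem3p5:
  fixes \<Omega> :: "(real ^ 'n) set"
    and T Amin A B :: real
    and a :: "'n \<Rightarrow> 'n \<Rightarrow> (real ^ 'n) \<times> real \<Rightarrow> real"
    and b :: "'n \<Rightarrow> (real ^ 'n) \<times> real \<Rightarrow> real"
    and f :: "(real ^ 'n) \<times> real \<Rightarrow> real \<Rightarrow> real \<Rightarrow> real"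
    and \<phi> :: "real ^ 'n \<Rightarrow> real"
    and ul uu :: "(real ^ 'n) \<times> real \<Rightarrow> real"
  assumes domain: "open \<Omega>" "connected \<Omega>" "\<Omega> \<noteq> {}"
    and unbounded: "\<not> bounded \<Omega>"
    and T: "T > 0"
    and Amin: "Amin > 0"
    and elliptic: "\<forall>(x, t)\<in>cyl \<Omega> T. \<forall>\<eta> :: real ^ 'n.
          Amin * (norm \<eta>)\<^sup>2 \<le> (\<Sum>i\<in>UNIV. \<Sum>j\<in>UNIV. a i j (x, t) * \<eta> $ i * \<eta> $ j)"
    and phi: "integrable lebesgue \<phi>" "\<forall>x. \<phi> x \<ge> 0"
    and ul: "continuous_on (closure (cyl \<Omega> T)) ul" "ul \<in> C21 \<Omega> T" "ul \<in> Linfty (closure (cyl \<Omega> T))"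
    and uu: "continuous_on (closure (cyl \<Omega> T)) uu" "uu \<in> C21 \<Omega> T" "uu \<in> Linfty (closure (cyl \<Omega> T))"
    and AB: "A \<ge> 0" "B \<ge> 0"
    and i: "\<forall>z\<in>cyl \<Omega> T. P_op a b f \<phi> \<Omega> T ul z \<ge> P_op a b f \<phi> \<Omega> T uu z"
    and ii: "\<forall>z\<in>parabolic_boundary \<Omega> T. ul z \<le> uu z"
    and iii: "\<forall>(x, t)\<in>cyl \<Omega> T. \<forall>\<eta> :: real ^ 'n.
          (\<Sum>i\<in>UNIV. \<Sum>j\<in>UNIV. a i j (x, t) * \<eta> $ i * \<eta> $ j) \<le> A * (1 + (norm x)\<^sup>2) * (norm \<eta>)\<^sup>2"
    and iv: "\<forall>(x, t)\<in>cyl \<Omega> T. (\<Sum>i\<in>UNIV. b i (x, t) * x $ i) \<le> B * (1 + (norm x)\<^sup>2)"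
    and v: "integrable lebesgue (\<lambda>x. \<phi> x * (norm x)\<^sup>2)"
    and vi: "upper_lipschitz_u f (cyl \<Omega> T) (K_set \<Omega> T \<phi> ul uu)"
    and vii: "lipschitz_v f (cyl \<Omega> T) (K_set \<Omega> T \<phi> ul uu)"
    and viii: "nondecreasing_v f (cyl \<Omega> T) (K_set \<Omega> T \<phi> ul uu)"
  shows "\<forall>z\<in>closure (cyl \<Omega> T). ul z \<le> uu z"
proof (rule ccontr)
  define w where "w z = ul z - uu z" for z
  define Q where "Q = closure (cyl \<Omega> T)"
  assume "\<not> (\<forall>z\<in>closure (cyl \<Omega> T). ul z \<le> uu z)"
  then obtain z1 where z1: "z1 \<in> Q" "w z1 > 0" by (auto simp: Q_def w_def not_le)
  have Q: "Q = closure \<Omega> \<times> {0..T}" using T by (simp add: Q_def closure_cyl)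
  have cyl_Q: "cyl \<Omega> T \<subseteq> Q" unfolding Q_def by (rule closure_subset)
  have \<phi>0: "\<phi> x \<ge> 0" for x using phi by simp
  have interior_Q: "closure (\<Omega> \<times> {0<..<T}) = Q" using T by (simp add: Q closure_Times)
  have bounded: "\<exists>M\<ge>0. \<forall>z\<in>Q. \<bar>u z\<bar> \<le> M"
    if "continuous_on Q u" "u \<in> Linfty Q" for u :: "(real ^ 'n) \<times> real \<Rightarrow> real"
    using continuous_Linfty_bounded[of "\<Omega> \<times> {0<..<T}" u] that domain(1)
    unfolding interior_Q by (metis open_Times open_greaterThanLessThan)
  obtain M1 M2 where "M1 \<ge> 0" "\<forall>z\<in>Q. \<bar>ul z\<bar> \<le> M1" "M2 \<ge> 0" "\<forall>z\<in>Q. \<bar>uu z\<bar> \<le> M2"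
    using bounded[of ul] bounded[of uu] ul uu by (auto simp: Q_def)
  then obtain M where M: "M \<ge> 0" and ulM: "\<And>z. z \<in> Q \<Longrightarrow> \<bar>ul z\<bar> \<le> M"
    and uuM: "\<And>z. z \<in> Q \<Longrightarrow> \<bar>uu z\<bar> \<le> M"
    using that[of "M1 + M2"] by (metis add_increasing add_increasing2 add_nonneg_nonneg)
  have slice: "continuous_on \<Omega> (\<lambda>y. u (y, t))" if "continuous_on Q u" "t \<in> {0..T}"
    for u :: "(real ^ 'n) \<times> real \<Rightarrow> real" and t
    by (rule continuous_on_compose2[OF that(1)])
      (use that(2) closure_subset in \<open>auto simp: Q intro!: continuous_intros\<close>)
  have contQ: "continuous_on Q ul" "continuous_on Q uu" using ul uu by (simp_all add: Q_def)
  have memQ: "(y, t) \<in> Q" if "y \<in> \<Omega>" "t \<in> {0..T}" for y t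
    using that closure_subset by (auto simp: Q)
  define N where "N = M * (LINT y|lebesgue. \<phi> y)"
  have J_bound: "\<bar>nonlocal \<Omega> \<phi> u z\<bar> \<le> N"
    if "continuous_on Q u" "\<And>z. z \<in> Q \<Longrightarrow> \<bar>u z\<bar> \<le> M" "z \<in> Q" for u z
  proof -
    obtain x t where [simp]: "z = (x, t)" by fastforce
    have t: "t \<in> {0..T}" using that(3) by (simp add: Q)
    show ?thesis
      unfolding nonlocal_def N_def
      using kernel_integral_bounded[OF phi(1) \<phi>0 domain(1) slice[OF that(1) t], of M x] that(2) memQ t M
      by simp
  qed
  obtain k1 where k1: "k1 \<ge> 0" "\<And>z p1 p2 q. z \<in> cyl \<Omega> T \<Longrightarrow> (p1, q) \<in> K_set \<Omega> T \<phi> ul uu \<Longrightarrow>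
      (p2, q) \<in> K_set \<Omega> T \<phi> ul uu \<Longrightarrow> p2 \<le> p1 \<Longrightarrow> f z p1 q - f z p2 q \<le> k1 * (p1 - p2)"
    using vi unfolding upper_lipschitz_u_def by metis
  obtain k2 where k2: "k2 \<ge> 0" "\<And>z p q1 q2. z \<in> cyl \<Omega> T \<Longrightarrow> (p, q1) \<in> K_set \<Omega> T \<phi> ul uu \<Longrightarrow>
      (p, q2) \<in> K_set \<Omega> T \<phi> ul uu \<Longrightarrow> \<bar>f z p q1 - f z p q2\<bar> \<le> k2 * \<bar>q1 - q2\<bar>"
    using vii unfolding lipschitz_v_def by metis
  have reaction: "f z (ul z) (nonlocal \<Omega> \<phi> ul z) - f z (uu z) (nonlocal \<Omega> \<phi> uu z)
      \<le> k1 * w z + k2 * max 0 (nonlocal \<Omega> \<phi> ul z - nonlocal \<Omega> \<phi> uu z)"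
    if z: "z \<in> cyl \<Omega> T" and "w z \<ge> 0" for z
  proof -
    have zQ: "z \<in> closure (cyl \<Omega> T)" using z closure_subset by auto
    have K: "(p, q) \<in> K_set \<Omega> T \<phi> ul uu"
      if "p = ul z \<or> p = uu z" "q = nonlocal \<Omega> \<phi> ul z \<or> q = nonlocal \<Omega> \<phi> uu z" for p q
      by (rule K_set_memI[where M = M and N = N and z = z])
        (use ulM uuM J_bound[OF contQ(1) ulM] J_bound[OF contQ(2) uuM] zQ that in \<open>auto simp: Q_def\<close>)
    have "f z (ul z) (nonlocal \<Omega> \<phi> ul z) - f z (uu z) (nonlocal \<Omega> \<phi> ul z) \<le> k1 * w z"
      using k1(2)[OF z K K, of "ul z" "nonlocal \<Omega> \<phi> ul z" "uu z"] \<open>w z \<ge> 0\<close> by (simp add: w_def)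
    \<comment> \<open>Only upper bounds of the nonlocal difference are available from the barrier, so its negative part must not
      enter with a Lipschitz estimate; monotonicity disposes of it.\<close>
    moreover have "f z (uu z) (nonlocal \<Omega> \<phi> ul z) - f z (uu z) (nonlocal \<Omega> \<phi> uu z)
        \<le> k2 * max 0 (nonlocal \<Omega> \<phi> ul z - nonlocal \<Omega> \<phi> uu z)"
    proof (cases "nonlocal \<Omega> \<phi> ul z \<le> nonlocal \<Omega> \<phi> uu z")
      case True
      then have "f z (uu z) (nonlocal \<Omega> \<phi> ul z) \<le> f z (uu z) (nonlocal \<Omega> \<phi> uu z)"
        using viii z K unfolding nondecreasing_v_def by blast
      then show ?thesis using True by simp
    next
      case False
      then show ?thesis
        using k2(2)[OF z K K, of "uu z" "nonlocal \<Omega> \<phi> ul z" "nonlocal \<Omega> \<phi> uu z"] by simp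
    qed
    ultimately show ?thesis by linarith
  qed
  define C where "C = (LINT y|lebesgue. \<phi> y * (2 + 2 * (norm y)\<^sup>2))"
  have C: "C \<ge> 0" unfolding C_def using \<phi>0 by (intro Bochner_Integration.integral_nonneg) simp
  define n where "n = real CARD('n)"
  \<comment> \<open>The summand \<open>1\<close> makes the supersolution inequality strict.\<close>
  define \<mu> where "\<mu> = 2 * n * A + 2 * B + k1 + k2 * C + 1"
  have \<mu>: "\<mu> \<ge> 0" using AB k1 k2 C by (simp add: \<mu>_def n_def)
  have contw: "continuous_on Q w" unfolding w_def[abs_def] using contQ by (intro continuous_intros)
  have w2M: "w z \<le> 2 * M" if "z \<in> Q" for z
    using ulM[OF that] uuM[OF that] by (simp add: w_def)
  obtain z m where zQ: "z \<in> Q" and m: "m > 0" and eq: "w z = m * barrier \<mu> z"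
    and le: "\<And>z'. z' \<in> Q \<Longrightarrow> w z' \<le> m * barrier \<mu> z'"
    using touching_barrier[of "closure \<Omega>" T w "2 * M" \<mu> z1] contw w2M \<mu> z1 unfolding Q by auto
  have bpos: "barrier \<mu> z > 0"
    by (auto simp: barrier_def intro!: mult_pos_pos add_pos_nonneg)
  have wz: "w z > 0" using eq m bpos by simp
  have z: "z \<in> cyl \<Omega> T"
    using nonpos_off_cyl[OF T domain(1), of w z] contw ii zQ wz by (force simp: Q_def w_def)
  obtain x t where zxt: "z = (x, t)" by fastforce
  have t: "t \<in> {0..T}" using z zxt by (simp add: cyl_def)
  have le': "\<forall>z\<in>cyl \<Omega> T. ul z - uu z \<le> m * barrier \<mu> z"
    using le cyl_Q by (auto simp: w_def)
  have eq': "ul (x, t) - uu (x, t) = m * barrier \<mu> (x, t)" using eq by (simp add: w_def zxt)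
  note touch = derivatives_at_touching_point[OF domain(1) ul(2) uu(2) z[unfolded zxt] le' eq']
  define E where "E = m * exp (\<mu> * t)"
  define H where "H = E * (1 + (norm x)\<^sup>2)"
  have E: "E > 0" using m by (simp add: E_def)
  have barrier: "m * barrier \<mu> z = H" by (simp add: H_def E_def barrier_def zxt)
  \<comment> \<open>\<open>H\<close> is the common value of the difference and of the multiple of the barrier at the touching point; each of
    the following terms is compared with it.\<close>
  have second: "(\<Sum>i\<in>UNIV. \<Sum>j\<in>UNIV. a i j z * partial_x i (partial_x j ul) z)
      - (\<Sum>i\<in>UNIV. \<Sum>j\<in>UNIV. a i j z * partial_x i (partial_x j uu) z) \<le> 2 * n * A * H"
  proof -
    have "0 \<le> (\<Sum>i\<in>UNIV. \<Sum>j\<in>UNIV. a i j z * \<eta> $ i * \<eta> $ j)" for \<eta> :: "real ^ 'n"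
      using elliptic z Amin order_trans[of 0 "Amin * (norm \<eta>)\<^sup>2"] unfolding zxt by fastforce
    from touch(2)[of "\<lambda>i j. a i j z", OF this]
    have "(\<Sum>i\<in>UNIV. \<Sum>j\<in>UNIV. a i j z * partial_x i (partial_x j ul) z)
      - (\<Sum>i\<in>UNIV. \<Sum>j\<in>UNIV. a i j z * partial_x i (partial_x j uu) z) \<le> E * (2 * (\<Sum>i\<in>UNIV. a i i z))"
      by (simp add: E_def zxt)
    also have "\<dots> \<le> E * (2 * (n * (A * (1 + (norm x)\<^sup>2))))"
    proof -
      have "a k k z \<le> A * (1 + (norm x)\<^sup>2)" for k
      proof -
        have "a i j z * axis k 1 $ i * axis k 1 $ j = (if j = k then if i = k then a k k z else 0 else 0)" for i j
          by (simp add: axis_def)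
        then have "(\<Sum>i\<in>UNIV. \<Sum>j\<in>UNIV. a i j z * axis k 1 $ i * axis k 1 $ j) = a k k z"
          by simp
        moreover have "(\<Sum>i\<in>UNIV. \<Sum>j\<in>UNIV. a i j z * axis k 1 $ i * axis k 1 $ j)
            \<le> A * (1 + (norm x)\<^sup>2) * (norm (axis k 1 :: real ^ 'n))\<^sup>2"
          using iii z unfolding zxt by blast
        ultimately show ?thesis by simp
      qed
      then have "(\<Sum>i\<in>UNIV. a i i z) \<le> n * (A * (1 + (norm x)\<^sup>2))"
        unfolding n_def by (intro sum_bounded_above) simp
      then show ?thesis using E by simp
    qed
    finally show ?thesis by (simp add: H_def mult_ac)
  qed
  have first: "(\<Sum>i\<in>UNIV. b i z * partial_x i ul z) - (\<Sum>i\<in>UNIV. b i z * partial_x i uu z) \<le> 2 * B * H"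
  proof -
    have "(\<Sum>i\<in>UNIV. b i z * partial_x i ul z) - (\<Sum>i\<in>UNIV. b i z * partial_x i uu z)
        = (\<Sum>i\<in>UNIV. b i z * (partial_x i ul z - partial_x i uu z))"
      by (simp add: right_diff_distrib sum_subtractf)
    also have "\<dots> = 2 * E * (\<Sum>i\<in>UNIV. b i z * x $ i)"
      using touch(1) by (simp add: zxt E_def sum_distrib_left mult_ac)
    also have "\<dots> \<le> 2 * E * (B * (1 + (norm x)\<^sup>2))"
      using iv z E unfolding zxt by (intro mult_left_mono) auto
    finally show ?thesis by (simp add: H_def mult_ac)
  qed
  have "nonlocal \<Omega> \<phi> ul z - nonlocal \<Omega> \<phi> uu z \<le> C * H"
  proof -
    have "nonlocal \<Omega> \<phi> ul z - nonlocal \<Omega> \<phi> uu z = (LINT y:\<Omega>|lebesgue. \<phi> (x - y) * w (y, t))"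
    proof -
      have int: "set_integrable lebesgue \<Omega> (\<lambda>y. \<phi> (x - y) * u (y, t))"
        if "continuous_on Q u" "\<And>z. z \<in> Q \<Longrightarrow> \<bar>u z\<bar> \<le> M" for u
        by (rule set_integrable_kernel[OF phi(1) domain(1) slice[OF that(1) t], of M])
          (use that(2) memQ t in auto)
      show ?thesis
        unfolding nonlocal_def zxt w_def right_diff_distrib
        using set_integral_diff(2)[OF int[OF contQ(1) ulM] int[OF contQ(2) uuM]] by simp
    qed
    also have "\<dots> \<le> E * (1 + (norm x)\<^sup>2) * C"
      unfolding C_def
    proof (rule kernel_integral_le_quadratic[OF phi(1) \<phi>0 v domain(1) slice[OF contw t]])
      fix y assume "y \<in> \<Omega>"
      then have y: "(y, t) \<in> Q" using memQ t by simp
      show "\<bar>w (y, t)\<bar> \<le> 2 * M" using ulM[OF y] uuM[OF y] by (simp add: w_def)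
      show "w (y, t) \<le> E * (1 + (norm y)\<^sup>2)" using le[OF y] by (simp add: E_def barrier_def)
    qed (use E in simp)
    finally show ?thesis by (simp add: H_def mult_ac)
  qed
  moreover have H: "H > 0" using barrier m bpos by (metis mult_pos_pos)
  ultimately have "max 0 (nonlocal \<Omega> \<phi> ul z - nonlocal \<Omega> \<phi> uu z) \<le> C * H"
    using C by simp
  then have "k2 * max 0 (nonlocal \<Omega> \<phi> ul z - nonlocal \<Omega> \<phi> uu z) \<le> k2 * (C * H)"
    using k2(1) by (rule mult_left_mono)
  then have zeroth: "f z (ul z) (nonlocal \<Omega> \<phi> ul z) - f z (uu z) (nonlocal \<Omega> \<phi> uu z)
      \<le> k1 * H + k2 * (C * H)"
    using reaction[OF z less_imp_le[OF wz]] eq barrier by simp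
  have time: "\<mu> * H \<le> partial_t T ul z - partial_t T uu z"
    using touch(3) barrier by (simp add: zxt)
  have "\<mu> * H \<le> 2 * n * A * H + 2 * B * H + (k1 * H + k2 * (C * H))"
    using i[rule_format, OF z] second first zeroth time unfolding P_op_def by linarith
  then have "H \<le> 0" by (simp add: \<mu>_def algebra_simps)
  with H show False by simp
qed

end
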